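(* Let $M$ be a matroid with ground set $E(M)=\{1,\dots,n\}$, let $\mathbb{k}$ be a field and $S=\mathbb{k}[x_1,\dots,x_n]$. Let $B_1,\dots,B_t$ be the blocks of $M$. For each $1\le i\le t$, let \[0\leftarrow S(-r_i)^{n_{0,i}}\leftarrow S(-(r_i+1))^{n_{1,i}}\leftarrow\cdots\leftarrow S(-(r_i+l_i))^{n_{l_i,i}}\leftarrow 0\] be a (linear) $\mathbb{N}$-graded minimal free resolution of the $S$-ideal $S\mathcal{F}(B_i)$. Put $l=l_1+\cdots+l_t$, $r=r_1+\cdots+r_t$ and \[\beta_i=\sum_{u_1+u_2+\cdots+u_t=i} n_{u_1,1}n_{u_2,2}\cdots n_{u_t,t}.\] Then \[0\leftarrow S(-r)^{\beta_0}\leftarrow S(-(r+1))^{\beta_1}\leftarrow\cdots\leftarrow S(-(r+l))^{\beta_l}\leftarrow 0\] is a minimal free resolution of $\mathcal{F}(M)$.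
   Context: For $\tau\subset\{1,\dots,n\}$, $\mathbf{x}^\tau=\prod_{j\in\tau}x_j$. The facet ideal of a matroid $N$ whose ground set is a subset $E$ of $\{1,\dots,n\}$ is the ideal $\mathcal{F}(N)$ of $\mathbb{k}[x_j: j\in E]$ generated by $\mathbf{x}^\sigma$ for $\sigma$ a basis of $N$; $S\mathcal{F}(N)$ denotes the ideal of $S$ generated by the same monomials. The blocks of $M$ are the equivalence classes of the relation on $E(M)$ where $e\sim f$ iff $e=f$ or some circuit of $M$ contains both $e$ and $f$; each block $B$ is regarded as a matroid on $B$ whose independent sets are the independent sets of $M$ contained in $B$. $S(-a)$ denotes $S$ with grading shifted by $a$. A complex $\cdots\leftarrow X_{i-1}\xleftarrow{\phi_i}X_i\leftarrow\cdots$ is minimal if $\operatorname{im}\phi_i\subset\mathfrak{m}X_{i-1}$ for all $i$, where $\mathfrak{m}=\langle x_1,\dots,x_n\rangle$; a minimal free resolution of a module is a minimal free complex exact except at degree $0$ whose cokernel at degree $0$ is the module, with degree-preserving maps in the graded case. *)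

theory Defs
  imports
    "HOL-Library.Poly_Mapping"
    "HOL-Algebra.Module"
    "HOL-Algebra.Ideal"
begin

section \<open>Matroids\<close>

locale matroid =
  fixes E :: "'a set" and indep :: "'a set \<Rightarrow> bool"
  assumes finite_ground: "finite E"
    and indep_ground: "indep X \<Longrightarrow> X \<subseteq> E"
    and indep_empty: "indep {}"
    and indep_subset: "indep X \<Longrightarrow> Y \<subseteq> X \<Longrightarrow> indep Y"
    and augment: "indep X \<Longrightarrow> indep Y \<Longrightarrow> card X < card Y \<Longrightarrow> \<exists>y\<in>Y - X. indep (insert y X)"

definition basis :: "('a set \<Rightarrow> bool) \<Rightarrow> 'a set \<Rightarrow> bool" where
  "basis indep X \<longleftrightarrow> indep X \<and> (\<forall>Y. indep Y \<longrightarrow> X \<subseteq> Y \<longrightarrow> Y = X)"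

definition circuit :: "'a set \<Rightarrow> ('a set \<Rightarrow> bool) \<Rightarrow> 'a set \<Rightarrow> bool" where
  "circuit E indep C \<longleftrightarrow> C \<subseteq> E \<and> \<not> indep C \<and> (\<forall>D. D \<subset> C \<longrightarrow> indep D)"

definition block_rel :: "'a set \<Rightarrow> ('a set \<Rightarrow> bool) \<Rightarrow> ('a \<times> 'a) set" where
  "block_rel E indep =
     {(e, f). e \<in> E \<and> f \<in> E \<and> (e = f \<or> (\<exists>C. circuit E indep C \<and> e \<in> C \<and> f \<in> C))}"

definition blocks :: "'a set \<Rightarrow> ('a set \<Rightarrow> bool) \<Rightarrow> 'a set set" where
  "blocks E indep = E // block_rel E indep"

definition restrict_indep :: "('a set \<Rightarrow> bool) \<Rightarrow> 'a set \<Rightarrow> 'a set \<Rightarrow> bool" where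
  "restrict_indep indep B X \<longleftrightarrow> indep X \<and> X \<subseteq> B"

section \<open>Polynomial rings and facet ideals\<close>

type_synonym ('v, 'k) mpoly = "('v \<Rightarrow>\<^sub>0 nat) \<Rightarrow>\<^sub>0 'k"

text \<open>The polynomial ring in the variables indexed by \<open>A\<close>, as a subring of the ring of all
  polynomials with variables indexed by the type \<open>'v\<close>.\<close>

definition poly_ring :: "'v set \<Rightarrow> ('v, 'k::field) mpoly ring" where
  "poly_ring A =
     \<lparr>carrier = {p. \<forall>t\<in>Poly_Mapping.keys p. Poly_Mapping.keys t \<subseteq> A},
      mult = (*), one = 1, zero = 0, add = (+)\<rparr>"

definition mvar :: "'v \<Rightarrow> ('v, 'k::field) mpoly" where
  "mvar j = Poly_Mapping.single (Poly_Mapping.single j 1) 1"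

definition irrelevant_ideal :: "'v set \<Rightarrow> ('v, 'k::field) mpoly set" where
  "irrelevant_ideal A = Idl\<^bsub>poly_ring A\<^esub> (mvar ` A)"

definition mon_degree :: "('v \<Rightarrow>\<^sub>0 nat) \<Rightarrow> nat" where
  "mon_degree t = (\<Sum>j\<in>Poly_Mapping.keys t. Poly_Mapping.lookup t j)"

definition homogeneous :: "'v set \<Rightarrow> nat \<Rightarrow> ('v, 'k::field) mpoly set" where
  "homogeneous A d =
     {p \<in> carrier (poly_ring A). \<forall>t\<in>Poly_Mapping.keys p. mon_degree t = d}"

text \<open>The ideal of the polynomial ring in the variables \<open>A\<close> generated by the monomials of the
  bases.  For a matroid on \<open>E \<subseteq> A\<close>, the choice \<open>A = E\<close> is the facet ideal itself, and a larger
  \<open>A\<close> gives the ideal generated by the same monomials in the larger polynomial ring.\<close>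

definition facet_ideal :: "'v set \<Rightarrow> ('v set \<Rightarrow> bool) \<Rightarrow> ('v, 'k::field) mpoly set" where
  "facet_ideal A indep = Idl\<^bsub>poly_ring A\<^esub> {\<Prod>j\<in>\<sigma>. mvar j | \<sigma>. basis indep \<sigma>}"

section \<open>Graded modules\<close>

record ('a, 'b) graded_module = "('a, 'b) module" +
  component :: "nat \<Rightarrow> 'b set"

text \<open>The graded free module \<open>S(-as!0) \<oplus> S(-as!1) \<oplus> \<dots>\<close> over \<open>S = poly_ring A\<close>: a vector is a
  function on the positions of \<open>as\<close>, extended by \<open>0\<close>, and \<open>S(-a)\<close> has \<open>S\<^bsub>d - a\<^esub>\<close> as its
  component of degree \<open>d\<close>, which is zero for \<open>d < a\<close>.  The ring fields \<open>mult\<close> and \<open>one\<close> of a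
  module record carry no information.\<close>

definition graded_free ::
    "'v set \<Rightarrow> nat list \<Rightarrow> (('v, 'k::field) mpoly, nat \<Rightarrow> ('v, 'k) mpoly) graded_module" where
  "graded_free A as =
     \<lparr>carrier = {v. (\<forall>i<length as. v i \<in> carrier (poly_ring A)) \<and> (\<forall>i\<ge>length as. v i = 0)},
      mult = undefined, one = undefined,
      zero = (\<lambda>i. 0), add = (\<lambda>v w i. v i + w i), smult = (\<lambda>p v i. p * v i),
      component = (\<lambda>d. {v. (\<forall>i<length as. v i \<in> (if as ! i \<le> d then homogeneous A (d - as ! i) else {0}))
                          \<and> (\<forall>i\<ge>length as. v i = 0)})\<rparr>"

definition graded_ideal ::
    "'v set \<Rightarrow> ('v, 'k::field) mpoly set \<Rightarrow> (('v, 'k) mpoly, ('v, 'k) mpoly) graded_module" where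
  "graded_ideal A I =
     \<lparr>carrier = I, mult = undefined, one = undefined, zero = 0, add = (+), smult = (*),
      component = (\<lambda>d. I \<inter> homogeneous A d)\<rparr>"

definition graded_hom ::
    "('a, 'r) ring_scheme \<Rightarrow> ('a, 'b, 'x) graded_module_scheme \<Rightarrow> ('a, 'c, 'y) graded_module_scheme
      \<Rightarrow> ('b \<Rightarrow> 'c) set" where
  "graded_hom R M N =
     {f \<in> carrier M \<rightarrow> carrier N.
        (\<forall>x\<in>carrier M. \<forall>y\<in>carrier M. f (x \<oplus>\<^bsub>M\<^esub> y) = f x \<oplus>\<^bsub>N\<^esub> f y) \<and>
        (\<forall>a\<in>carrier R. \<forall>x\<in>carrier M. f (a \<odot>\<^bsub>M\<^esub> x) = a \<odot>\<^bsub>N\<^esub> f x) \<and>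
        (\<forall>d. f ` component M d \<subseteq> component N d)}"

text \<open>The submodule \<open>I M\<close>, generated by the products of elements of \<open>I\<close> and \<open>M\<close>.\<close>

definition ideal_smult ::
    "('a, 'r) ring_scheme \<Rightarrow> 'a set \<Rightarrow> ('a, 'b, 'x) module_scheme \<Rightarrow> 'b set" where
  "ideal_smult R I M =
     \<Inter>{H. submodule H R M \<and> {a \<odot>\<^bsub>M\<^esub> x | a x. a \<in> I \<and> x \<in> carrier M} \<subseteq> H}"

section \<open>Minimal graded free resolutions\<close>

text \<open>The free module in homological degree \<open>i\<close> is \<open>graded_free A (as i)\<close>, and \<open>\<phi> i\<close> maps
  homological degree \<open>i\<close> to \<open>i - 1\<close>; the value \<open>\<phi> 0\<close> is irrelevant.  That the cokernel of
  \<open>\<phi> 1\<close> is \<open>N\<close> means that there is a graded surjection onto \<open>N\<close> whose kernel is the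
  image of \<open>\<phi> 1\<close>.\<close>

definition minimal_free_resolution ::
    "'v set \<Rightarrow> (nat \<Rightarrow> nat list)
      \<Rightarrow> (nat \<Rightarrow> (nat \<Rightarrow> ('v, 'k::field) mpoly) \<Rightarrow> (nat \<Rightarrow> ('v, 'k) mpoly))
      \<Rightarrow> (('v, 'k) mpoly, 'b) graded_module \<Rightarrow> bool" where
  "minimal_free_resolution A as \<phi> N \<longleftrightarrow>
     (let S = poly_ring A; X = (\<lambda>i. graded_free A (as i)) in
       (\<forall>i. \<phi> (Suc i) \<in> graded_hom S (X (Suc i)) (X i)) \<and>
       (\<forall>i. \<phi> (Suc i) ` carrier (X (Suc i)) \<subseteq> ideal_smult S (irrelevant_ideal A) (X i)) \<and>
       (\<forall>i\<ge>1. {x \<in> carrier (X i). \<phi> i x = \<zero>\<^bsub>X (i - 1)\<^esub>} = \<phi> (Suc i) ` carrier (X (Suc i))) \<and>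
       (\<exists>\<epsilon>\<in>graded_hom S (X 0) N.
          \<epsilon> ` carrier (X 0) = carrier N \<and>
          {x \<in> carrier (X 0). \<epsilon> x = \<zero>\<^bsub>N\<^esub>} = \<phi> 1 ` carrier (X 1)))"

text \<open>The shape \<open>0 \<leftarrow> S(-r)\<^bsup>b 0\<^esup> \<leftarrow> S(-(r + 1))\<^bsup>b 1\<^esup> \<leftarrow> \<dots> \<leftarrow> S(-(r + l))\<^bsup>b l\<^esup> \<leftarrow> 0\<close>.\<close>

definition linear_shape :: "nat \<Rightarrow> nat \<Rightarrow> (nat \<Rightarrow> nat) \<Rightarrow> nat \<Rightarrow> nat list" where
  "linear_shape r l b i = (if i \<le> l then replicate (b i) (r + i) else [])"

lemma poly_ring_simps:
  "carrier (poly_ring A) = {p. \<forall>t\<in>Poly_Mapping.keys p. Poly_Mapping.keys t \<subseteq> A}"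
  "mult (poly_ring A) = (*)" "one (poly_ring A) = 1" "zero (poly_ring A) = 0" "add (poly_ring A) = (+)"
  by (simp_all add: poly_ring_def)

lemma poly_ring_add_closed:
  "p \<in> carrier (poly_ring A) \<Longrightarrow> q \<in> carrier (poly_ring A) \<Longrightarrow> p + q \<in> carrier (poly_ring A)"
  using Poly_Mapping.keys_add[of p q] by (auto simp: poly_ring_simps)

lemma poly_ring_mult_closed:
  "p \<in> carrier (poly_ring A) \<Longrightarrow> q \<in> carrier (poly_ring A) \<Longrightarrow> p * q \<in> carrier (poly_ring A)"
  unfolding poly_ring_simps mem_Collect_eq
proof
  fix t
  assume p: "\<forall>t\<in>Poly_Mapping.keys p. Poly_Mapping.keys t \<subseteq> A"
    and q: "\<forall>t\<in>Poly_Mapping.keys q. Poly_Mapping.keys t \<subseteq> A"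
    and t: "t \<in> Poly_Mapping.keys (p * q)"
  obtain a b where "t = a + b" "a \<in> Poly_Mapping.keys p" "b \<in> Poly_Mapping.keys q"
    using t keys_mult[of p q] by blast
  then show "Poly_Mapping.keys t \<subseteq> A"
    using p q Poly_Mapping.keys_add[of a b] by blast
qed

lemma poly_ring_misc_closed:
  "p \<in> carrier (poly_ring A) \<Longrightarrow> - p \<in> carrier (poly_ring A)"
  "0 \<in> carrier (poly_ring A)"
  "1 \<in> carrier (poly_ring A)"
  by (auto simp: poly_ring_simps in_keys_iff)

lemma cring_poly_ring: "cring (poly_ring A)"
proof (rule cringI)
  show "abelian_group (poly_ring A)"
  proof (rule abelian_groupI)
    show "\<exists>y\<in>carrier (poly_ring A). y \<oplus>\<^bsub>poly_ring A\<^esub> x = \<zero>\<^bsub>poly_ring A\<^esub>"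
      if "x \<in> carrier (poly_ring A)" for x
      by (rule bexI[OF _ poly_ring_misc_closed(1)[OF that]]) (simp add: poly_ring_simps(4,5))
  qed (simp_all only: poly_ring_simps(4,5) poly_ring_add_closed poly_ring_misc_closed
         add.assoc add.commute add.left_commute add_0_left add_0_right)
  show "comm_monoid (poly_ring A)"
    by (rule comm_monoidI)
      (simp_all only: poly_ring_simps(2,3) poly_ring_mult_closed poly_ring_misc_closed
         mult.assoc mult.commute mult.left_commute mult_1_left mult_1_right)
qed (simp only: poly_ring_simps(2,5) distrib_right)

lemma graded_free_simps:
  "v \<in> carrier (graded_free A as) \<longleftrightarrow>
     (\<forall>i<length as. v i \<in> carrier (poly_ring A)) \<and> (\<forall>i\<ge>length as. v i = 0)"
  "\<zero>\<^bsub>graded_free A as\<^esub> = (\<lambda>i. 0)"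
  "v \<oplus>\<^bsub>graded_free A as\<^esub> w = (\<lambda>i. v i + w i)"
  "p \<odot>\<^bsub>graded_free A as\<^esub> v = (\<lambda>i. p * v i)"
  by (simp_all add: graded_free_def)

lemma module_graded_free: "module (poly_ring A) (graded_free A as)"
proof (rule moduleI)
  show "abelian_group (graded_free A as)"
  proof (rule abelian_groupI)
    show "\<exists>y\<in>carrier (graded_free A as). y \<oplus>\<^bsub>graded_free A as\<^esub> x = \<zero>\<^bsub>graded_free A as\<^esub>"
      if "x \<in> carrier (graded_free A as)" for x
      using that
      by (intro bexI[of _ "\<lambda>i. - x i"]) (simp_all add: graded_free_simps poly_ring_misc_closed)
  qed (simp_all add: graded_free_simps poly_ring_add_closed poly_ring_misc_closed ac_simps)
qed (simp_all add: cring_poly_ring graded_free_simps poly_ring_mult_closed poly_ring_simps(2,3,5)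
       distrib_left distrib_right mult.assoc)

end

theory Submission
  imports Defs
begin

text \<open>
  A set contains a basis of \<open>M\<close> iff it contains a basis of every block, so the facet ideal of \<open>M\<close> is
  the intersection of the monomial ideals \<open>SF(B\<^sub>i)\<close>, whose generators live in disjoint sets of
  variables.  The product of two such resolutions \<open>F\<close> and \<open>G\<close>, of monomial ideals \<open>I\<close> and \<open>J\<close> in
  disjoint sets of variables, is again a resolution: the columns of \<open>F \<otimes> G\<close> are exact up to their
  augmentations, so it suffices that \<open>I G\<close> is exact.  To see this, set the variables of \<open>I\<close> to
  zero in \<open>G\<close>, one at a time.  This keeps \<open>G\<close> a resolution of \<open>J\<close>, because these variables do not
  occur in the generators of \<open>J\<close>.  Afterwards \<open>G\<close> is a direct sum of copies of an exact complex,
  indexed by the monomials in the variables of \<open>I\<close>, and \<open>I G\<close> consists of those copies whose index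
  lies in \<open>I\<close>.  All matrix entries of the product are linear forms or zero, whence minimality.
\<close>

section \<open>Blocks of a matroid\<close>

text \<open>The given resolutions live over all of S, so the matrices of one block may involve the
  variables of every other. Passing to the polynomial ring of a block would call for uniqueness of
  minimal resolutions and base change; substituting zero stays inside S and alters matrix entries
  only, not ranks or shifts.

  Only one of two factors needs this: F enters through its exact columns and its ideal I alone. So
  the blocks are joined one at a time, F being the product so far and G the next block, freed of the
  variables of all blocks in F. The start is the unit ideal, the intersection over no blocks.

  A cycle of the product is sent to I G by augmenting each column. There it is a boundary; a
  preimage, lifted entrywise through the augmentation, gives a boundary whose subtraction leaves a
  cycle with columns augmenting to zero.

  Keeping all homological degrees in one matrix makes the product simply indexed by pairs. The price
  is that vectors mix degrees, so lifts have to be normalised in degree 0.\<close>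

context matroid
begin

text \<open>A basis of the restriction to \<open>Z\<close>, tested on single elements, which is the
  form that \<open>augment\<close> contradicts.\<close>

definition maximal_indep_in :: "'a set \<Rightarrow> 'a set \<Rightarrow> bool" where
  "maximal_indep_in Z W \<longleftrightarrow> indep W \<and> W \<subseteq> Z \<and> (\<forall>z\<in>Z - W. \<not> indep (insert z W))"

lemma indep_finite: "indep X \<Longrightarrow> finite X"
  using indep_ground finite_ground finite_subset by blast

lemma indep_extend:
  assumes "indep X" "X \<subseteq> Z"
  obtains W where "maximal_indep_in Z W" "X \<subseteq> W"
proof -
  let ?S = "{W. indep W \<and> X \<subseteq> W \<and> W \<subseteq> Z}"
  have "finite ?S"
    by (rule finite_subset[of _ "Pow E"]) (use indep_ground finite_ground in auto)
  moreover have "X \<in> ?S" using assms by auto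
  ultimately obtain W where W0: "W \<in> ?S" "\<forall>V\<in>?S. W \<subseteq> V \<longrightarrow> W = V"
    using finite_has_maximal[of ?S] by (metis (lifting) empty_iff)
  have W: "W \<in> ?S" "\<And>V. V \<in> ?S \<Longrightarrow> W \<subseteq> V \<Longrightarrow> W = V"
    using W0 by (blast, metis (lifting))
  have "\<not> indep (insert z W)" if "z \<in> Z - W" for z
    using W(1) W(2)[of "insert z W"] that by auto
  then show ?thesis using W(1) that[of W] unfolding maximal_indep_in_def by auto
qed

lemma card_le_maximal_indep:
  assumes "maximal_indep_in Z W" "indep V" "V \<subseteq> Z"
  shows "card V \<le> card W"
proof (rule ccontr)
  assume "\<not> card V \<le> card W"
  then obtain y where "y \<in> V - W" "indep (insert y W)"
    using augment[of W V] assms unfolding maximal_indep_in_def by auto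
  then show False using assms unfolding maximal_indep_in_def by auto
qed

section \<open>Circuit elimination\<close>

lemma circuit_in_dependent:
  assumes "X \<subseteq> E" "\<not> indep X"
  obtains C where "circuit E indep C" "C \<subseteq> X"
proof -
  let ?S = "{W. \<not> indep W \<and> W \<subseteq> X}"
  have "finite ?S"
    by (rule finite_subset[of _ "Pow E"]) (use assms finite_ground in auto)
  moreover have "X \<in> ?S" using assms by auto
  ultimately obtain C where C0: "C \<in> ?S" "\<forall>V\<in>?S. V \<subseteq> C \<longrightarrow> C = V"
    using finite_has_minimal[of ?S] by (metis (lifting) empty_iff)
  have C: "C \<in> ?S" "\<And>V. V \<in> ?S \<Longrightarrow> V \<subseteq> C \<Longrightarrow> C = V"
    using C0 by (blast, metis (lifting))
  have "indep D" if "D \<subset> C" for D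
    using C(1) C(2)[of D] that by auto
  then show ?thesis using C(1) assms(1) that[of C] unfolding circuit_def by auto
qed

text \<open>The circuit puts \<open>f\<close> in the closure of \<open>Z\<close>, so the rank stays
  the same. If \<open>insert f W\<close> were independent, a maximal \<open>V\<close> in
  \<open>Z\<close> containing \<open>C - {f}\<close> would be smaller and could be augmented from
  it: by \<open>f\<close>, and then \<open>C\<close> would be contained in an independent set, or
  inside \<open>Z\<close>, against maximality.\<close>

lemma maximal_indep_in_closure:
  assumes W: "maximal_indep_in Z W" and C: "circuit E indep C" "f \<in> C" "C - {f} \<subseteq> Z"
  shows "maximal_indep_in (insert f Z) W"
proof (rule ccontr)
  assume "\<not> ?thesis"
  then have f: "f \<notin> W" "indep (insert f W)"
    using W unfolding maximal_indep_in_def by auto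
  have fZ: "f \<notin> Z" using f W unfolding maximal_indep_in_def by auto
  have "indep (C - {f})" using C unfolding circuit_def by auto
  then obtain V where V: "maximal_indep_in Z V" "C - {f} \<subseteq> V"
    using indep_extend C(3) by metis
  have "card V \<le> card W"
    using card_le_maximal_indep[OF W] V unfolding maximal_indep_in_def by auto
  moreover have "finite W" using W indep_finite unfolding maximal_indep_in_def by auto
  ultimately have "card V < card (insert f W)" using f by simp
  then obtain y where y: "y \<in> insert f W - V" "indep (insert y V)"
    using augment[of V "insert f W"] V f unfolding maximal_indep_in_def by auto
  show False
  proof (cases "y = f")
    case True
    then have "C \<subseteq> insert y V" using V(2) by auto
    then show False using y indep_subset C(1) unfolding circuit_def by auto
  next
    case False
    then have "y \<in> Z - V" using y W unfolding maximal_indep_in_def by auto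
    then show False using y V unfolding maximal_indep_in_def by auto
  qed
qed

text \<open>Both removed elements lie in the closure of \<open>C1 \<union> C2 - {e, f}\<close>:
  first \<open>f\<close>, through \<open>C2\<close>, which misses \<open>e\<close>, then
  \<open>e\<close>, through \<open>C1\<close>. So a maximal independent \<open>W\<close> there stays
  maximal, and the circuit in \<open>insert e W\<close> must use \<open>e\<close>.\<close>

lemma strong_circuit_elimination:
  assumes C1: "circuit E indep C1" and C2: "circuit E indep C2"
    and f: "f \<in> C1 \<inter> C2" and e: "e \<in> C1 - C2"
  obtains C where "circuit E indep C" "e \<in> C" "C \<subseteq> C1 \<union> C2 - {f}"
proof -
  let ?Z = "C1 \<union> C2 - {e, f}"
  obtain W where W: "maximal_indep_in ?Z W"
    using indep_extend[OF indep_empty, of ?Z] by auto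
  have "maximal_indep_in (insert f ?Z) W"
    using maximal_indep_in_closure[OF W C2, of f] f e by auto
  then have "maximal_indep_in (insert e (insert f ?Z)) W"
    by (rule maximal_indep_in_closure[OF _ C1]) (use e in auto)
  then have "\<not> indep (insert e W)"
    using W e unfolding maximal_indep_in_def by auto
  moreover have "insert e W \<subseteq> E"
    using W e C1 C2 unfolding maximal_indep_in_def circuit_def by auto
  ultimately obtain C where C: "circuit E indep C" "C \<subseteq> insert e W"
    using circuit_in_dependent by metis
  have "e \<in> C"
    using C W indep_subset[of W C] unfolding maximal_indep_in_def circuit_def by auto
  moreover have "C \<subseteq> C1 \<union> C2 - {f}"
    using C(2) W e f unfolding maximal_indep_in_def by auto
  ultimately show ?thesis using C(1) that by auto
qed

lemma circuit_not_psubset: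
  "circuit E indep C \<Longrightarrow> circuit E indep D \<Longrightarrow> \<not> C \<subset> D"
  unfolding circuit_def by blast

text \<open>This is transitivity of the block relation. Eliminating a common element
  \<open>f\<close> in two ways gives \<open>C3\<close> through \<open>e\<close> and
  \<open>C4\<close> through \<open>g\<close>. Either \<open>C3\<close> and \<open>C2\<close> have a
  smaller union, or \<open>C3\<close> contains all of \<open>C1 - C2\<close>; then it meets
  \<open>C4\<close>, which is not inside \<open>C2\<close>, and the union of \<open>C3\<close> and
  \<open>C4\<close> misses \<open>f\<close>.\<close>

lemma meeting_circuits_connected:
  assumes "circuit E indep C1" "circuit E indep C2" "C1 \<inter> C2 \<noteq> {}" "e \<in> C1" "g \<in> C2"
  shows "\<exists>C. circuit E indep C \<and> e \<in> C \<and> g \<in> C"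
  using assms
proof (induction "card (C1 \<union> C2)" arbitrary: C1 C2 rule: less_induct)
  case less
  show ?case
  proof (rule ccontr)
    assume no: "\<not> ?thesis"
    have e: "e \<in> C1 - C2" and g: "g \<in> C2 - C1" using no less.prems by auto
    obtain f where f: "f \<in> C1 \<inter> C2" using less.prems by auto
    have fin: "finite (C1 \<union> C2)"
      using less.prems(1,2) finite_ground finite_subset unfolding circuit_def by (metis finite_UnI)
    obtain C3 where C3: "circuit E indep C3" "e \<in> C3" "C3 \<subseteq> C1 \<union> C2 - {f}"
      using strong_circuit_elimination less.prems(1,2) f e by metis
    obtain C4 where C4: "circuit E indep C4" "g \<in> C4" "C4 \<subseteq> C2 \<union> C1 - {f}"
      using strong_circuit_elimination[OF less.prems(2,1), of f g] f g by auto
    \<comment> \<open>Otherwise \<open>C3\<close> would lie in \<open>C1 - {f}\<close>, properly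
      inside a circuit.\<close>
    have "C3 \<inter> C2 \<noteq> {}"
      using circuit_not_psubset[OF C3(1) less.prems(1)] C3 f by auto
    then have "\<not> card (C3 \<union> C2) < card (C1 \<union> C2)"
      using less.hyps[OF _ C3(1) less.prems(2) _ C3(2) less.prems(5)] no by auto
    then have "C3 \<union> C2 = C1 \<union> C2"
      using card_subset_eq[OF fin, of "C3 \<union> C2"] C3(3) card_mono[OF fin, of "C3 \<union> C2"] by fastforce
    moreover have "\<not> C4 \<subseteq> C2"
      using circuit_not_psubset[OF C4(1) less.prems(2)] C4 f by auto
    ultimately have "C3 \<inter> C4 \<noteq> {}" using C4(3) by auto
    moreover have "card (C3 \<union> C4) < card (C1 \<union> C2)"
      by (rule psubset_card_mono[OF fin]) (use C3(3) C4(3) f in auto)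
    ultimately show False
      using less.hyps[OF _ C3(1) C4(1) _ C3(2) C4(2)] no by auto
  qed
qed

section \<open>The matroid as the direct sum of its blocks\<close>

lemma equiv_block_rel: "equiv E (block_rel E indep)"
proof (rule equivI)
  show "block_rel E indep \<subseteq> E \<times> E" "refl_on E (block_rel E indep)" "sym (block_rel E indep)"
    by (auto simp: block_rel_def refl_on_def sym_def)
  show "trans (block_rel E indep)"
    unfolding trans_def block_rel_def
    using meeting_circuits_connected by (simp, blast)
qed

text \<open>A circuit is nonempty and its elements are pairwise related, so every circuit lies
  inside one block.\<close>

lemma indep_iff_blocks:
  assumes "X \<subseteq> E"
  shows "indep X \<longleftrightarrow> (\<forall>K\<in>blocks E indep. indep (X \<inter> K))"
proof
  assume "indep X"
  then show "\<forall>K\<in>blocks E indep. indep (X \<inter> K)" using indep_subset by blast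
next
  assume *: "\<forall>K\<in>blocks E indep. indep (X \<inter> K)"
  show "indep X"
  proof (rule ccontr)
    assume "\<not> indep X"
    then obtain C where C: "circuit E indep C" "C \<subseteq> X"
      using circuit_in_dependent assms by metis
    then obtain c where c: "c \<in> C" using indep_empty unfolding circuit_def by fastforce
    let ?K = "block_rel E indep `` {c}"
    have "c \<in> E" using c C assms by auto
    then have K: "?K \<in> blocks E indep" unfolding blocks_def by (rule quotientI)
    have "C \<subseteq> ?K" using C c assms unfolding block_rel_def by blast
    then have "C \<subseteq> X \<inter> ?K" using C by auto
    moreover have "indep (X \<inter> ?K)" using * K by blast
    ultimately show False using C(1) indep_subset unfolding circuit_def by meson
  qed
qed

lemma blocks_disjoint: "K \<in> blocks E indep \<Longrightarrow> L \<in> blocks E indep \<Longrightarrow> K \<noteq> L \<Longrightarrow> K \<inter> L = {}"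
  using quotient_disj[OF equiv_block_rel, of K L] unfolding blocks_def by simp

lemma Union_blocks: "\<Union> (blocks E indep) = E"
  unfolding blocks_def by (rule Union_quotient[OF equiv_block_rel])

text \<open>Bases of a direct sum are the unions of bases of the summands. With \<open>T\<close> the
  support of a monomial this makes the facet ideal an intersection over the blocks.\<close>

lemma basis_subset_iff_blocks:
  "(\<exists>\<sigma>. basis indep \<sigma> \<and> \<sigma> \<subseteq> T) \<longleftrightarrow>
     (\<forall>K\<in>blocks E indep. \<exists>\<sigma>. basis (restrict_indep indep K) \<sigma> \<and> \<sigma> \<subseteq> T)"
proof (intro iffI ballI)
  fix K assume "\<exists>\<sigma>. basis indep \<sigma> \<and> \<sigma> \<subseteq> T" and K: "K \<in> blocks E indep"
  then obtain \<sigma> where \<sigma>: "basis indep \<sigma>" "\<sigma> \<subseteq> T" by auto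
  have "Y = \<sigma> \<inter> K" if Y: "restrict_indep indep K Y" "\<sigma> \<inter> K \<subseteq> Y" for Y
  proof -
    \<comment> \<open>Adding \<open>Y\<close>, a set inside \<open>K\<close>, does not change the
      trace of the basis on any other block.\<close>
    have "indep ((\<sigma> \<union> Y) \<inter> L)" if L: "L \<in> blocks E indep" for L
    proof (cases "L = K")
      case True
      then have "(\<sigma> \<union> Y) \<inter> L = Y" using Y unfolding restrict_indep_def by blast
      then show ?thesis using Y(1) unfolding restrict_indep_def by simp
    next
      case False
      then have "(\<sigma> \<union> Y) \<inter> L \<subseteq> \<sigma>"
        using Y blocks_disjoint[OF K L] unfolding restrict_indep_def by auto
      then show ?thesis using \<sigma> indep_subset unfolding basis_def by blast
    qed
    moreover have "\<sigma> \<union> Y \<subseteq> E"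
      using \<sigma> Y indep_ground unfolding basis_def restrict_indep_def by auto
    ultimately have "indep (\<sigma> \<union> Y)" using indep_iff_blocks by blast
    then have "\<sigma> \<union> Y = \<sigma>" using \<sigma>(1) unfolding basis_def by auto
    then show ?thesis using Y unfolding restrict_indep_def by auto
  qed
  moreover have "restrict_indep indep K (\<sigma> \<inter> K)"
    using \<sigma> indep_subset unfolding basis_def restrict_indep_def by auto
  ultimately show "\<exists>\<sigma>. basis (restrict_indep indep K) \<sigma> \<and> \<sigma> \<subseteq> T"
    using \<sigma>(2) unfolding basis_def by blast
next
  assume "\<forall>K\<in>blocks E indep. \<exists>\<sigma>. basis (restrict_indep indep K) \<sigma> \<and> \<sigma> \<subseteq> T"
  then obtain s where s: "\<And>K. K \<in> blocks E indep \<Longrightarrow> basis (restrict_indep indep K) (s K) \<and> s K \<subseteq> T"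
    by metis
  let ?\<sigma> = "\<Union>K\<in>blocks E indep. s K"
  have sK: "indep (s K)" "s K \<subseteq> K" if "K \<in> blocks E indep" for K
    using s[OF that] unfolding basis_def restrict_indep_def by auto
  have int: "?\<sigma> \<inter> K = s K" if "K \<in> blocks E indep" for K
    using sK that blocks_disjoint[OF that] by blast
  have "?\<sigma> \<subseteq> E" using sK(1) indep_ground by blast
  then have ind: "indep ?\<sigma>" using indep_iff_blocks int sK(1) by simp
  have "Y = ?\<sigma>" if Y: "indep Y" "?\<sigma> \<subseteq> Y" for Y
  proof -
    have "Y \<inter> K = s K" if K: "K \<in> blocks E indep" for K
    proof -
      have "restrict_indep indep K (Y \<inter> K)"
        using Y indep_subset unfolding restrict_indep_def by auto
      moreover have "s K \<subseteq> Y \<inter> K" using K Y sK by blast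
      ultimately show ?thesis using s[OF K] unfolding basis_def by blast
    qed
    moreover have "Y = (\<Union>K\<in>blocks E indep. Y \<inter> K)"
      using indep_ground[OF Y(1)] Union_blocks by auto
    ultimately show ?thesis by simp
  qed
  with ind have "basis indep ?\<sigma>" unfolding basis_def by blast
  moreover have "?\<sigma> \<subseteq> T" using s by blast
  ultimately show "\<exists>\<sigma>. basis indep \<sigma> \<and> \<sigma> \<subseteq> T" by (intro exI conjI)
qed

end

section \<open>Polynomials and their monomials\<close>

text \<open>Applied to a polynomial it selects terms, applied to an exponent vector it selects
  variables; both uses occur below.\<close>

lift_definition part :: "('a \<Rightarrow> bool) \<Rightarrow> ('a \<Rightarrow>\<^sub>0 'b::zero) \<Rightarrow> ('a \<Rightarrow>\<^sub>0 'b)" is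
  "\<lambda>Q f a. if Q a then f a else 0"
  by (rule finite_subset) auto

lemma lookup_part: "Poly_Mapping.lookup (part Q p) t = (if Q t then Poly_Mapping.lookup p t else 0)"
  by transfer simp

lemma keys_part: "Poly_Mapping.keys (part Q p) = {t \<in> Poly_Mapping.keys p. Q t}"
  by (auto simp: in_keys_iff lookup_part split: if_splits)

lemma part_zero [simp]: "part Q 0 = 0"
  by (rule poly_mapping_eqI) (simp add: lookup_part)

lemma part_add: "part Q (p + q) = part Q p + part Q (q :: 'a \<Rightarrow>\<^sub>0 'b::monoid_add)"
  by (rule poly_mapping_eqI) (simp add: lookup_part lookup_add)

lemma part_sum: "part Q (\<Sum>x\<in>X. f x) = (\<Sum>x\<in>X. part Q (f x :: 'a \<Rightarrow>\<^sub>0 'b::comm_monoid_add))"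
  by (induction X rule: infinite_finite_induct) (simp_all add: part_add)

lemma part_single: "part Q (Poly_Mapping.single t c) = (if Q t then Poly_Mapping.single t c else 0)"
  by (rule poly_mapping_eqI) (auto simp: lookup_part lookup_single when_def)

lemma part_id: "(\<And>t. t \<in> Poly_Mapping.keys p \<Longrightarrow> Q t) \<Longrightarrow> part Q p = p"
  by (rule poly_mapping_eqI) (auto simp: lookup_part in_keys_iff)

lemma poly_mapping_sum_singles:
  fixes p :: "'a \<Rightarrow>\<^sub>0 'b::comm_monoid_add"
  shows "(\<Sum>t\<in>Poly_Mapping.keys p. Poly_Mapping.single t (Poly_Mapping.lookup p t)) = p"
proof (rule poly_mapping_eqI)
  fix s
  have "(\<Sum>t\<in>Poly_Mapping.keys p. Poly_Mapping.lookup p t when t = s) =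
      (\<Sum>t\<in>Poly_Mapping.keys p. if s = t then Poly_Mapping.lookup p t else 0)"
    by (rule sum.cong) (auto simp: when_def)
  then show "Poly_Mapping.lookup (\<Sum>t\<in>Poly_Mapping.keys p. Poly_Mapping.single t (Poly_Mapping.lookup p t)) s
      = Poly_Mapping.lookup p s"
    by (auto simp: lookup_sum lookup_single in_keys_iff)
qed

lemma mult_eq_sum_singles:
  fixes p q :: "'a::monoid_add \<Rightarrow>\<^sub>0 'b::semiring_0"
  shows "p * q = (\<Sum>s\<in>Poly_Mapping.keys p. \<Sum>t\<in>Poly_Mapping.keys q.
      Poly_Mapping.single (s + t) (Poly_Mapping.lookup p s * Poly_Mapping.lookup q t))"
proof -
  have "p * q = (\<Sum>s\<in>Poly_Mapping.keys p. Poly_Mapping.single s (Poly_Mapping.lookup p s)) *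
      (\<Sum>t\<in>Poly_Mapping.keys q. Poly_Mapping.single t (Poly_Mapping.lookup q t))"
    by (simp only: poly_mapping_sum_singles)
  then show ?thesis by (simp only: sum_product mult_single)
qed

text \<open>Selection is linear over factors that cannot influence it. This yields both the
  multiplicativity of \<open>kill\<close> and the splitting in
  \<open>exact_on_mono_ideal\<close>.\<close>

lemma part_mult_left:
  fixes p q :: "'a::monoid_add \<Rightarrow>\<^sub>0 'b::semiring_0"
  assumes "\<And>s t. s \<in> Poly_Mapping.keys p \<Longrightarrow> t \<in> Poly_Mapping.keys q \<Longrightarrow> Q (s + t) \<longleftrightarrow> R t"
  shows "part Q (p * q) = p * part R q"
proof -
  have "part Q (p * q) = (\<Sum>s\<in>Poly_Mapping.keys p. \<Sum>t\<in>Poly_Mapping.keys q.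
      Poly_Mapping.single s (Poly_Mapping.lookup p s) *
      part R (Poly_Mapping.single t (Poly_Mapping.lookup q t)))"
    by (subst mult_eq_sum_singles)
      (auto simp: part_sum part_single mult_single assms intro!: sum.cong)
  also have "\<dots> = p * part R q"
    by (simp only: sum_product[symmetric] part_sum[symmetric] poly_mapping_sum_singles)
  finally show ?thesis .
qed

lemma keys_add_nat: "Poly_Mapping.keys (s + t :: 'v \<Rightarrow>\<^sub>0 nat) = Poly_Mapping.keys s \<union> Poly_Mapping.keys t"
  by (auto simp: in_keys_iff lookup_add)

section \<open>Substitution of zero and division by monomials\<close>

definition avoids :: "'v set \<Rightarrow> ('v, 'k::zero) mpoly \<Rightarrow> bool" where
  "avoids D p \<longleftrightarrow> (\<forall>t\<in>Poly_Mapping.keys p. Poly_Mapping.keys t \<inter> D = {})"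

text \<open>The substitution of \<open>0\<close> for the variables in \<open>D\<close>.\<close>

definition kill :: "'v set \<Rightarrow> ('v, 'k::zero) mpoly \<Rightarrow> ('v, 'k) mpoly" where
  "kill D = part (\<lambda>t. Poly_Mapping.keys t \<inter> D = {})"

lemma kill_mult:
  fixes p q :: "('v, 'k::comm_semiring_1) mpoly"
  shows "kill D (p * q) = kill D p * kill D q"
proof -
  let ?Q = "\<lambda>t. Poly_Mapping.keys t \<inter> D = {}"
  \<comment> \<open>Every term of the second summand contains a variable of \<open>D\<close>, and so
    does every term of its multiples.\<close>
  have p: "p = kill D p + part (\<lambda>t. \<not> ?Q t) p"
    unfolding kill_def by (rule poly_mapping_eqI) (simp add: lookup_part lookup_add)
  have "kill D (kill D p * q) = kill D p * kill D q"
    unfolding kill_def by (rule part_mult_left) (auto simp: keys_part keys_add_nat)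
  moreover have "kill D (part (\<lambda>t. \<not> ?Q t) p * q) = part (\<lambda>t. \<not> ?Q t) p * part (\<lambda>_. False) q"
    unfolding kill_def by (rule part_mult_left) (auto simp: keys_part keys_add_nat)
  moreover have "part (\<lambda>_. False) q = 0"
    by (rule poly_mapping_eqI) (simp add: lookup_part)
  ultimately show ?thesis
    by (subst p) (simp add: distrib_right part_add kill_def)
qed

lemma kill_sum: "kill D (\<Sum>x\<in>X. f x) = (\<Sum>x\<in>X. kill D (f x :: ('v, 'k::comm_monoid_add) mpoly))"
  unfolding kill_def by (rule part_sum)

lemma kill_zero [simp]: "kill D 0 = 0"
  by (simp add: kill_def)

lemma avoids_kill: "avoids D (kill D p)"
  by (simp add: avoids_def kill_def keys_part)

lemma avoids_kill_other: "avoids C p \<Longrightarrow> avoids C (kill D p)"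
  by (simp add: avoids_def kill_def keys_part)

lemma kill_id: "avoids D p \<Longrightarrow> kill D p = p"
  unfolding kill_def avoids_def by (rule part_id) auto

text \<open>The second property carries support conditions on \<open>p\<close>, such as its set of
  variables, over to the quotient.\<close>

lemma single_mult_dvd:
  fixes p :: "('v, 'k::semiring_1) mpoly"
  assumes "\<And>t. t \<in> Poly_Mapping.keys p \<Longrightarrow> \<exists>s. t = \<tau> + s"
  obtains q where "p = Poly_Mapping.single \<tau> 1 * q"
    "\<And>s. s \<in> Poly_Mapping.keys q \<Longrightarrow> \<tau> + s \<in> Poly_Mapping.keys p"
proof -
  define q where "q = (\<Sum>t\<in>Poly_Mapping.keys p. Poly_Mapping.single (t - \<tau>) (Poly_Mapping.lookup p t))"
  have shift: "\<tau> + (t - \<tau>) = t" if "t \<in> Poly_Mapping.keys p" for t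
    using assms[OF that] by auto
  have "Poly_Mapping.single \<tau> 1 * q =
      (\<Sum>t\<in>Poly_Mapping.keys p. Poly_Mapping.single t (Poly_Mapping.lookup p t))"
    unfolding q_def sum_distrib_left by (rule sum.cong) (auto simp: mult_single shift)
  then have "p = Poly_Mapping.single \<tau> 1 * q"
    by (simp only: poly_mapping_sum_singles)
  moreover have "\<tau> + s \<in> Poly_Mapping.keys p" if "s \<in> Poly_Mapping.keys q" for s
  proof -
    have "s \<in> (\<Union>t\<in>Poly_Mapping.keys p. Poly_Mapping.keys (Poly_Mapping.single (t - \<tau>) (Poly_Mapping.lookup p t)))"
      using that keys_sum[of "\<lambda>t. Poly_Mapping.single (t - \<tau>) (Poly_Mapping.lookup p t)" "Poly_Mapping.keys p"]
      unfolding q_def by blast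
    then show ?thesis using shift by (auto split: if_splits)
  qed
  ultimately show ?thesis using that by blast
qed

lemma lookup_single_mult:
  fixes p :: "('v, 'k::semiring_1) mpoly"
  shows "Poly_Mapping.lookup (Poly_Mapping.single \<tau> 1 * p) (\<tau> + s) = Poly_Mapping.lookup p s"
proof -
  have "Poly_Mapping.single \<tau> 1 * p = Poly_Mapping.single \<tau> 1 *
      (\<Sum>t\<in>Poly_Mapping.keys p. Poly_Mapping.single t (Poly_Mapping.lookup p t))"
    by (simp only: poly_mapping_sum_singles)
  then have "Poly_Mapping.lookup (Poly_Mapping.single \<tau> 1 * p) (\<tau> + s) =
      (\<Sum>t\<in>Poly_Mapping.keys p. Poly_Mapping.lookup (Poly_Mapping.single t (Poly_Mapping.lookup p t)) s)"
    by (simp add: sum_distrib_left mult_single lookup_sum lookup_single)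
  also have "\<dots> = Poly_Mapping.lookup p s"
    by (simp only: lookup_sum[symmetric] poly_mapping_sum_singles)
  finally show ?thesis .
qed

text \<open>Multiplication by a monomial only shifts coefficients, so monomials are
  nonzerodivisors.\<close>

lemma single_mult_eq_0D:
  fixes p :: "('v, 'k::semiring_1) mpoly"
  assumes "Poly_Mapping.single \<tau> 1 * p = 0" shows "p = 0"
proof (rule poly_mapping_eqI)
  show "Poly_Mapping.lookup p s = Poly_Mapping.lookup 0 s" for s
    using lookup_single_mult[of \<tau> p s] assms by simp
qed

lemma keys_single_mult:
  fixes p :: "('v, 'k::semiring_1) mpoly"
  shows "s \<in> Poly_Mapping.keys p \<Longrightarrow> \<tau> + s \<in> Poly_Mapping.keys (Poly_Mapping.single \<tau> 1 * p)"
  by (simp add: in_keys_iff lookup_single_mult)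

section \<open>Polynomials in the variables A and their grading\<close>

abbreviation polys :: "'v set \<Rightarrow> ('v, 'k::field) mpoly set" where
  "polys A \<equiv> carrier (poly_ring A)"

lemmas polys_add = poly_ring_add_closed
lemmas polys_mult = poly_ring_mult_closed
lemmas polys_uminus = poly_ring_misc_closed(1)
lemmas polys_0 [simp] = poly_ring_misc_closed(2)
lemmas polys_1 [simp] = poly_ring_misc_closed(3)

lemma polys_diff: "p \<in> polys A \<Longrightarrow> q \<in> polys A \<Longrightarrow> p - q \<in> polys A"
  using polys_add[OF _ polys_uminus] by fastforce

lemma polys_sum: "(\<And>x. x \<in> X \<Longrightarrow> f x \<in> polys A) \<Longrightarrow> (\<Sum>x\<in>X. f x) \<in> polys A"
  by (induction X rule: infinite_finite_induct) (auto intro: polys_add)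

lemma polys_part: "p \<in> polys A \<Longrightarrow> part Q p \<in> polys A"
  by (simp add: poly_ring_simps keys_part)

lemma polys_kill: "p \<in> polys A \<Longrightarrow> kill D p \<in> polys A"
  unfolding kill_def by (rule polys_part)

lemma polys_single: "Poly_Mapping.keys t \<subseteq> A \<Longrightarrow> Poly_Mapping.single t c \<in> polys A"
  by (simp add: poly_ring_simps)

lemma polys_sign: "(- 1) ^ i \<in> polys A"
  by (induction i) (auto intro: polys_mult polys_uminus)

lemma mon_degree_superset:
  assumes "finite S" "Poly_Mapping.keys t \<subseteq> S"
  shows "mon_degree t = (\<Sum>j\<in>S. Poly_Mapping.lookup t j)"
  unfolding mon_degree_def by (rule sum.mono_neutral_left) (use assms in \<open>auto simp: in_keys_iff\<close>)

lemma mon_degree_add: "mon_degree (s + t) = mon_degree s + mon_degree t"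
proof -
  let ?S = "Poly_Mapping.keys s \<union> Poly_Mapping.keys t"
  have "mon_degree u = (\<Sum>j\<in>?S. Poly_Mapping.lookup u j)" if "Poly_Mapping.keys u \<subseteq> ?S" for u
    using that by (intro mon_degree_superset) auto
  from this[of s] this[of t] this[of "s + t"] show ?thesis
    by (simp add: keys_add_nat lookup_add sum.distrib)
qed

lemma homogeneous_mult:
  assumes "p \<in> homogeneous A a" "q \<in> homogeneous A b"
  shows "p * q \<in> homogeneous A (a + b)"
proof -
  have "mon_degree t = a + b" if "t \<in> Poly_Mapping.keys (p * q)" for t
    using that keys_mult[of p q] assms unfolding homogeneous_def by (auto simp: mon_degree_add)
  then show ?thesis using assms unfolding homogeneous_def by (auto intro: polys_mult)
qed

lemma homogeneous_0 [simp]: "0 \<in> homogeneous A a"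
  by (simp add: homogeneous_def)

lemma homogeneous_add: "p \<in> homogeneous A a \<Longrightarrow> q \<in> homogeneous A a \<Longrightarrow> p + q \<in> homogeneous A a"
  using Poly_Mapping.keys_add[of p q] unfolding homogeneous_def by (auto intro: polys_add)

lemma homogeneous_uminus: "p \<in> homogeneous A a \<Longrightarrow> - p \<in> homogeneous A a"
  unfolding homogeneous_def by (auto intro: polys_uminus simp: in_keys_iff)

lemma homogeneous_sum: "(\<And>x. x \<in> X \<Longrightarrow> f x \<in> homogeneous A a) \<Longrightarrow> (\<Sum>x\<in>X. f x) \<in> homogeneous A a"
  by (induction X rule: infinite_finite_induct) (auto intro: homogeneous_add)

lemma homogeneous_kill: "p \<in> homogeneous A a \<Longrightarrow> kill D p \<in> homogeneous A a"
  unfolding homogeneous_def by (auto simp: polys_kill) (auto simp: kill_def keys_part)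

lemma homogeneous_polys: "p \<in> homogeneous A a \<Longrightarrow> p \<in> polys A"
  by (simp add: homogeneous_def)

lemma homogeneous_1: "1 \<in> homogeneous A 0"
  unfolding homogeneous_def by (auto simp: mon_degree_def)

lemma homogeneous_sign: "p \<in> homogeneous A a \<Longrightarrow> (- 1) ^ i * p \<in> homogeneous A a"
  by (induction i) (auto intro: homogeneous_uminus)

section \<open>Monomial ideals\<close>

text \<open>A predicate on exponents in place of generators: membership is decided term by term, and
  intersection becomes conjunction. It is an ideal when \<open>P\<close> is
  \<open>upward\<close>.\<close>

definition mono_ideal :: "'v set \<Rightarrow> (('v \<Rightarrow>\<^sub>0 nat) \<Rightarrow> bool) \<Rightarrow> ('v, 'k::field) mpoly set" where
  "mono_ideal A P = {p \<in> polys A. \<forall>t\<in>Poly_Mapping.keys p. P t}"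

definition upward :: "(('v \<Rightarrow>\<^sub>0 nat) \<Rightarrow> bool) \<Rightarrow> bool" where
  "upward P \<longleftrightarrow> (\<forall>s t. P s \<longrightarrow> P (s + t))"

lemma mono_ideal_0 [simp]: "0 \<in> mono_ideal A P"
  by (simp add: mono_ideal_def)

lemma mono_ideal_add: "p \<in> mono_ideal A P \<Longrightarrow> q \<in> mono_ideal A P \<Longrightarrow> p + q \<in> mono_ideal A P"
  using Poly_Mapping.keys_add[of p q] unfolding mono_ideal_def by (auto intro: polys_add)

lemma mono_ideal_sum: "(\<And>x. x \<in> X \<Longrightarrow> f x \<in> mono_ideal A P) \<Longrightarrow> (\<Sum>x\<in>X. f x) \<in> mono_ideal A P"
  by (induction X rule: infinite_finite_induct) (auto intro: mono_ideal_add)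

lemma mono_ideal_mult:
  assumes "upward P" "p \<in> mono_ideal A P" "q \<in> polys A"
  shows "p * q \<in> mono_ideal A P"
proof -
  have "P t" if "t \<in> Poly_Mapping.keys (p * q)" for t
    using that keys_mult[of p q] assms(1,2) unfolding mono_ideal_def upward_def by auto
  then show ?thesis using assms unfolding mono_ideal_def by (auto intro: polys_mult)
qed

lemma mono_ideal_polys: "p \<in> mono_ideal A P \<Longrightarrow> p \<in> polys A"
  by (simp add: mono_ideal_def)

lemma mono_ideal_part: "p \<in> mono_ideal A P \<Longrightarrow> part Q p \<in> mono_ideal A P"
  unfolding mono_ideal_def by (auto intro: polys_part simp: keys_part)

lemma ideal_mono_ideal:
  assumes "upward P" shows "ideal (mono_ideal A P) (poly_ring A)"
proof (rule idealI)
  interpret cring "poly_ring A" by (rule cring_poly_ring)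
  show "ring (poly_ring A)" by (rule ring_axioms)
  have neg: "\<ominus>\<^bsub>poly_ring A\<^esub> p \<in> mono_ideal A P" if p: "p \<in> mono_ideal A P" for p
  proof -
    have "\<ominus>\<^bsub>poly_ring A\<^esub> p = - p"
      by (rule minus_equality) (use mono_ideal_polys[OF p] in \<open>simp_all add: poly_ring_simps(4,5) polys_uminus\<close>)
    moreover have "p * (- 1) \<in> mono_ideal A P"
      by (rule mono_ideal_mult[OF assms p]) (simp add: polys_uminus)
    ultimately show ?thesis by simp
  qed
  show "subgroup (mono_ideal A P) (add_monoid (poly_ring A))"
  proof (rule add.subgroupI)
    show "mono_ideal A P \<noteq> {}" using mono_ideal_0 by blast
  qed (auto simp: mono_ideal_polys poly_ring_simps(5) mono_ideal_add neg simp flip: a_inv_def)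
qed (simp_all add: poly_ring_simps(2) mono_ideal_mult[OF assms] mult.commute[of _ "_ :: ('a, 'b) mpoly"])

lemma ideal_sum_closed:
  assumes "ideal I (poly_ring A)" "\<And>x. x \<in> X \<Longrightarrow> f x \<in> I"
  shows "(\<Sum>x\<in>X. f x) \<in> I"
proof -
  interpret ideal I "poly_ring A" by fact
  have z: "0 \<in> I" using additive_subgroup.zero_closed[OF is_additive_subgroup] by (simp only: poly_ring_simps(4))
  have a: "p + q \<in> I" if "p \<in> I" "q \<in> I" for p q
    using additive_subgroup.a_closed[OF is_additive_subgroup that] by (simp only: poly_ring_simps(5))
  show ?thesis using assms(2)
    by (induction X rule: infinite_finite_induct) (auto intro: z a)
qed

section \<open>Facet ideals and the irrelevant ideal\<close>

lemma lookup_sum_single_1: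
  "finite \<sigma> \<Longrightarrow> Poly_Mapping.lookup (\<Sum>j\<in>\<sigma>. Poly_Mapping.single j (1::nat)) i = (if i \<in> \<sigma> then 1 else 0)"
  by (auto simp: lookup_sum lookup_single when_def)

lemma prod_mvar:
  "(\<Prod>j\<in>\<sigma>. mvar j) = Poly_Mapping.single (\<Sum>j\<in>\<sigma>. Poly_Mapping.single j 1) (1 :: 'k::field)"
  by (induction \<sigma> rule: infinite_finite_induct) (simp_all add: mvar_def mult_single)

text \<open>A squarefree monomial divides another monomial exactly when its variables occur there,
  so divisibility by a generator is a condition on \<open>Poly_Mapping.keys t\<close>.\<close>

lemma facet_ideal_eq_mono_ideal:
  fixes A :: "'v set"
  assumes "\<And>\<sigma>. basis indep \<sigma> \<Longrightarrow> finite \<sigma> \<and> \<sigma> \<subseteq> A"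
  shows "(facet_ideal A indep :: ('v, 'k::field) mpoly set) =
    mono_ideal A (\<lambda>t. \<exists>\<sigma>. basis indep \<sigma> \<and> \<sigma> \<subseteq> Poly_Mapping.keys t)"
    (is "?L = mono_ideal A ?P")
proof
  let ?G = "{\<Prod>j\<in>\<sigma>. mvar j | \<sigma>. basis indep \<sigma>} :: ('v, 'k) mpoly set"
  interpret cring "poly_ring A :: ('v, 'k) mpoly ring" by (rule cring_poly_ring)
  have keys: "Poly_Mapping.keys (\<Sum>j\<in>\<sigma>. Poly_Mapping.single j (1::nat)) = \<sigma>" if "basis indep \<sigma>" for \<sigma>
    using assms[OF that] by (auto simp: in_keys_iff lookup_sum_single_1[unfolded One_nat_def] split: if_splits)
  have up: "upward ?P" unfolding upward_def keys_add_nat by blast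
  have G: "?G \<subseteq> mono_ideal A ?P"
    using assms keys by (auto simp: prod_mvar mono_ideal_def polys_single)
  then show "?L \<subseteq> mono_ideal A ?P"
    unfolding facet_ideal_def by (rule genideal_minimal[OF ideal_mono_ideal[OF up]])
  have "?G \<subseteq> polys A" using G by (auto simp: mono_ideal_def)
  then have id: "ideal ?L (poly_ring A)" and sub: "?G \<subseteq> ?L"
    unfolding facet_ideal_def by (simp_all only: genideal_ideal genideal_self)
  interpret I: ideal ?L "poly_ring A" by (rule id)
  show "mono_ideal A ?P \<subseteq> ?L"
  proof
    fix p :: "('v, 'k) mpoly" assume p: "p \<in> mono_ideal A ?P"
    have "Poly_Mapping.single t (Poly_Mapping.lookup p t) \<in> ?L"
      if t: "t \<in> Poly_Mapping.keys p" for t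
    proof -
      obtain \<sigma> where \<sigma>: "basis indep \<sigma>" "\<sigma> \<subseteq> Poly_Mapping.keys t"
        using p t unfolding mono_ideal_def by auto
      let ?s = "\<Sum>j\<in>\<sigma>. Poly_Mapping.single j (1::nat)"
      \<comment> \<open>Truncated subtraction of exponents is exact, as each \<open>j\<close> in
        \<open>\<sigma>\<close> has exponent at least 1 in \<open>t\<close>.\<close>
      have ts: "?s + (t - ?s) = t"
        by (rule poly_mapping_eqI)
          (use \<sigma> assms[OF \<sigma>(1)] in \<open>auto simp: lookup_add lookup_minus lookup_sum_single_1[unfolded One_nat_def] in_keys_iff subset_iff\<close>)
      have "Poly_Mapping.keys (t - ?s) \<subseteq> Poly_Mapping.keys t"
        using keys_add_nat[of ?s "t - ?s"] ts by auto
      then have "Poly_Mapping.single (t - ?s) (Poly_Mapping.lookup p t) \<in> polys A"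
        using p t by (intro polys_single) (auto simp: mono_ideal_def poly_ring_simps)
      moreover have "(\<Prod>j\<in>\<sigma>. mvar j) \<in> ?L" using sub \<sigma>(1) by blast
      ultimately have "(\<Prod>j\<in>\<sigma>. mvar j) * Poly_Mapping.single (t - ?s) (Poly_Mapping.lookup p t)
          \<in> ?L"
        using I.I_r_closed by (simp add: poly_ring_simps(2))
      then show ?thesis by (simp add: prod_mvar mult_single ts[unfolded One_nat_def])
    qed
    then have "(\<Sum>t\<in>Poly_Mapping.keys p. Poly_Mapping.single t (Poly_Mapping.lookup p t)) \<in> ?L"
      by (rule ideal_sum_closed[OF id])
    then show "p \<in> ?L" by (simp only: poly_mapping_sum_singles)
  qed
qed

text \<open>Each term of degree 1 is a multiple of a variable. Complexes with linear entries are
  minimal for this reason.\<close>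

lemma homogeneous_1_in_irrelevant_ideal:
  fixes p :: "('v, 'k::field) mpoly"
  assumes "p \<in> homogeneous A 1" shows "p \<in> irrelevant_ideal A"
proof -
  interpret cring "poly_ring A :: ('v, 'k) mpoly ring" by (rule cring_poly_ring)
  have vars: "mvar ` A \<subseteq> (polys A :: ('v, 'k) mpoly set)" by (auto simp: mvar_def polys_single)
  have id: "ideal (irrelevant_ideal A) (poly_ring A :: ('v, 'k) mpoly ring)"
    unfolding irrelevant_ideal_def by (rule genideal_ideal[OF vars])
  have sub: "mvar ` A \<subseteq> (irrelevant_ideal A :: ('v, 'k) mpoly set)"
    unfolding irrelevant_ideal_def by (rule genideal_self[OF vars])
  interpret I: ideal "irrelevant_ideal A" "poly_ring A :: ('v, 'k) mpoly ring" by (rule id)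
  have "Poly_Mapping.single t (Poly_Mapping.lookup p t) \<in> irrelevant_ideal A"
    if t: "t \<in> Poly_Mapping.keys p" for t
  proof -
    have t1: "mon_degree t = 1" "Poly_Mapping.keys t \<subseteq> A"
      using assms t by (auto simp: homogeneous_def poly_ring_simps)
    then obtain j where j: "j \<in> Poly_Mapping.keys t" unfolding mon_degree_def
      by (metis all_not_in_conv sum.empty zero_neq_one)
    let ?s = "Poly_Mapping.single j (1::nat)"
    have ts: "?s + (t - ?s) = t"
      by (rule poly_mapping_eqI)
        (use j in \<open>auto simp: lookup_add lookup_minus lookup_single when_def in_keys_iff\<close>)
    have "Poly_Mapping.keys (t - ?s) \<subseteq> Poly_Mapping.keys t"
      using keys_add_nat[of ?s "t - ?s"] ts by auto
    then have "Poly_Mapping.single (t - ?s) (Poly_Mapping.lookup p t) \<in> polys A"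
      using t1 by (intro polys_single) auto
    moreover have "j \<in> A" using j t1 by auto
    then have "mvar j \<in> (irrelevant_ideal A :: ('v, 'k) mpoly set)" by (rule subsetD[OF sub imageI])
    ultimately have "mvar j * Poly_Mapping.single (t - ?s) (Poly_Mapping.lookup p t) \<in> irrelevant_ideal A"
      using I.I_r_closed by (simp add: poly_ring_simps(2))
    then show ?thesis by (simp add: mvar_def mult_single ts[unfolded One_nat_def])
  qed
  then have "(\<Sum>t\<in>Poly_Mapping.keys p. Poly_Mapping.single t (Poly_Mapping.lookup p t)) \<in> irrelevant_ideal A"
    by (rule ideal_sum_closed[OF id])
  then show ?thesis by (simp only: poly_mapping_sum_singles)
qed

section \<open>Linear resolutions of monomial ideals\<close>

text \<open>A linear free resolution of a monomial ideal generated in degree \<open>r\<close>, written as a single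
  square matrix \<open>d\<close> on a basis \<open>X\<close> of the total module, with \<open>h\<close> the homological degree, and an
  augmentation \<open>e\<close>.  Vectors are rows, and their values outside \<open>X\<close> are irrelevant.\<close>

locale linear_resolution =
  fixes A :: "'v set" and P :: "('v \<Rightarrow>\<^sub>0 nat) \<Rightarrow> bool" and r :: nat
    and X :: "'x set" and h :: "'x \<Rightarrow> nat"
    and d :: "'x \<Rightarrow> 'x \<Rightarrow> ('v, 'k::field) mpoly" and e :: "'x \<Rightarrow> ('v, 'k) mpoly"
  assumes finite_X: "finite X"
    and d_homogeneous: "\<And>x y. x \<in> X \<Longrightarrow> y \<in> X \<Longrightarrow> d x y \<in> homogeneous A 1"
    and d_degree: "\<And>x y. x \<in> X \<Longrightarrow> y \<in> X \<Longrightarrow> d x y \<noteq> 0 \<Longrightarrow> h x = Suc (h y)"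
    and e_homogeneous: "\<And>x. x \<in> X \<Longrightarrow> e x \<in> homogeneous A r"
    and e_degree: "\<And>x. x \<in> X \<Longrightarrow> e x \<noteq> 0 \<Longrightarrow> h x = 0"
    and dd: "\<And>x z. x \<in> X \<Longrightarrow> z \<in> X \<Longrightarrow> (\<Sum>y\<in>X. d x y * d y z) = 0"
    and de: "\<And>x. x \<in> X \<Longrightarrow> (\<Sum>y\<in>X. d x y * e y) = 0"
    and exact: "\<And>v. (\<And>x. x \<in> X \<Longrightarrow> v x \<in> polys A) \<Longrightarrow>
        (\<And>y. y \<in> X \<Longrightarrow> (\<Sum>x\<in>X. v x * d x y) = 0) \<Longrightarrow> (\<Sum>x\<in>X. v x * e x) = 0 \<Longrightarrow>
        \<exists>w. (\<forall>x\<in>X. w x \<in> polys A) \<and> (\<forall>y\<in>X. v y = (\<Sum>x\<in>X. w x * d x y))"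
    and image: "\<And>p. p \<in> mono_ideal A P \<longleftrightarrow>
        (\<exists>v. (\<forall>x\<in>X. v x \<in> polys A) \<and> p = (\<Sum>x\<in>X. v x * e x))"

lemma cycle_comp:
  fixes f :: "'x \<Rightarrow> 'y \<Rightarrow> 'a::comm_ring_1"
  assumes "\<And>x. x \<in> X \<Longrightarrow> (\<Sum>y\<in>Y. f x y * g y) = 0"
  shows "(\<Sum>y\<in>Y. (\<Sum>x\<in>X. w x * f x y) * g y) = 0"
proof -
  have "(\<Sum>y\<in>Y. (\<Sum>x\<in>X. w x * f x y) * g y) = (\<Sum>y\<in>Y. \<Sum>x\<in>X. w x * (f x y * g y))"
    by (simp add: sum_distrib_right mult.assoc)
  also have "\<dots> = (\<Sum>x\<in>X. w x * (\<Sum>y\<in>Y. f x y * g y))"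
    by (subst sum.swap) (simp add: sum_distrib_left)
  finally show ?thesis using assms by simp
qed

context linear_resolution
begin

lemma d_polys: "x \<in> X \<Longrightarrow> y \<in> X \<Longrightarrow> d x y \<in> polys A"
  using d_homogeneous homogeneous_polys by blast

lemma e_polys: "x \<in> X \<Longrightarrow> e x \<in> polys A"
  using e_homogeneous homogeneous_polys by blast

lemma d_eq_0: "x \<in> X \<Longrightarrow> y \<in> X \<Longrightarrow> h x \<noteq> Suc (h y) \<Longrightarrow> d x y = 0"
  using d_degree[of x y] by auto

lemma e_eq_0: "x \<in> X \<Longrightarrow> h x \<noteq> 0 \<Longrightarrow> e x = 0"
  using e_degree[of x] by auto

lemma e_mono_ideal: "x \<in> X \<Longrightarrow> e x \<in> mono_ideal A P"
  unfolding image using finite_X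
  by (intro exI[of _ "\<lambda>y. if y = x then 1 else 0"]) (simp add: if_distrib[of "\<lambda>c. c * _"] cong: if_cong)

text \<open>The rows of \<open>d\<close> in homological degree 0 vanish, so the entries of a lift
  there can be set to 0, and then \<open>e\<close> annihilates the lift. Corrections built from such
  lifts do not disturb augmentations.\<close>

lemma exact':
  assumes "\<And>x. x \<in> X \<Longrightarrow> v x \<in> polys A"
    "\<And>y. y \<in> X \<Longrightarrow> (\<Sum>x\<in>X. v x * d x y) = 0" "(\<Sum>x\<in>X. v x * e x) = 0"
  obtains w where "\<And>x. x \<in> X \<Longrightarrow> w x \<in> polys A" "\<And>y. y \<in> X \<Longrightarrow> v y = (\<Sum>x\<in>X. w x * d x y)"
    "\<And>x. x \<in> X \<Longrightarrow> w x * e x = 0"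
proof -
  obtain w where w: "\<forall>x\<in>X. w x \<in> polys A" "\<forall>y\<in>X. v y = (\<Sum>x\<in>X. w x * d x y)"
    using exact[of v] assms by blast
  let ?w = "\<lambda>x. if h x = 0 then 0 else w x"
  have "(\<Sum>x\<in>X. w x * d x y) = (\<Sum>x\<in>X. ?w x * d x y)" if "y \<in> X" for y
    using that by (intro sum.cong) (auto simp: d_eq_0)
  then show ?thesis
    using w by (intro that[of ?w]) (auto simp: e_eq_0)
qed

text \<open>Dually, \<open>e\<close> sees only degree 0; erasing the other degrees makes the
  preimage a cycle.\<close>

lemma image':
  assumes "p \<in> mono_ideal A P"
  obtains v where "\<And>x. x \<in> X \<Longrightarrow> v x \<in> polys A" "p = (\<Sum>x\<in>X. v x * e x)"
    "\<And>x y. x \<in> X \<Longrightarrow> y \<in> X \<Longrightarrow> v x * d x y = 0"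
proof -
  obtain v where v: "\<forall>x\<in>X. v x \<in> polys A" "p = (\<Sum>x\<in>X. v x * e x)"
    using image assms by blast
  let ?v = "\<lambda>x. if h x = 0 then v x else 0"
  have "(\<Sum>x\<in>X. v x * e x) = (\<Sum>x\<in>X. ?v x * e x)"
    by (intro sum.cong) (auto simp: e_eq_0)
  then show ?thesis
    using v by (intro that[of ?v]) (auto simp: d_eq_0)
qed

end

definition avoiding :: "'v set \<Rightarrow> 'x set \<Rightarrow> ('x \<Rightarrow> 'x \<Rightarrow> ('v, 'k::zero) mpoly) \<Rightarrow> ('x \<Rightarrow> ('v, 'k) mpoly) \<Rightarrow> bool" where
  "avoiding D X d e \<longleftrightarrow> (\<forall>x\<in>X. \<forall>y\<in>X. avoids D (d x y)) \<and> (\<forall>x\<in>X. avoids D (e x))"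

text \<open>For an \<open>upward\<close> predicate this means that the ideal is generated by
  monomials in the variables \<open>D\<close>.\<close>

definition depends_on :: "'v set \<Rightarrow> (('v \<Rightarrow>\<^sub>0 nat) \<Rightarrow> bool) \<Rightarrow> bool" where
  "depends_on D P \<longleftrightarrow> (\<forall>t. P t \<longleftrightarrow> P (part (\<lambda>j. j \<in> D) t))"

lemma part_partition:
  fixes t :: "'v \<Rightarrow>\<^sub>0 'b::monoid_add"
  shows "part (\<lambda>j. j \<in> D) t + part (\<lambda>j. j \<notin> D) t = t"
  by (rule poly_mapping_eqI) (simp add: lookup_add lookup_part)

lemma part_exponent_avoiding:
  fixes s :: "'v \<Rightarrow>\<^sub>0 nat"
  shows "Poly_Mapping.keys s \<inter> D = {} \<Longrightarrow> part (\<lambda>j. j \<in> D) s = 0"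
  by (rule poly_mapping_eqI) (auto simp: lookup_part in_keys_iff)

text \<open>If the matrices do not involve the variables in \<open>D\<close>, then the complex is the direct sum of its
  pieces \<open>\<tau> \<cdot> G\<close> over the monomials \<open>\<tau>\<close> in \<open>D\<close>, where \<open>G\<close> is the part free of \<open>D\<close>, and an ideal
  generated by monomials in \<open>D\<close> selects some of these pieces.\<close>

lemma exact_on_mono_ideal:
  fixes d :: "'x \<Rightarrow> 'x \<Rightarrow> ('v, 'k::field) mpoly"
  assumes "finite X" and av: "avoiding D X d e"
    and exact: "\<And>v. (\<And>x. x \<in> X \<Longrightarrow> v x \<in> polys A) \<Longrightarrow> (\<And>x. x \<in> X \<Longrightarrow> avoids D (v x)) \<Longrightarrow>
        (\<And>y. y \<in> X \<Longrightarrow> (\<Sum>x\<in>X. v x * d x y) = 0) \<Longrightarrow> (\<Sum>x\<in>X. v x * e x) = 0 \<Longrightarrow>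
        \<exists>w. (\<forall>x\<in>X. w x \<in> polys A) \<and> (\<forall>y\<in>X. v y = (\<Sum>x\<in>X. w x * d x y))"
    and Q: "upward Q" "depends_on D Q"
    and v: "\<And>x. x \<in> X \<Longrightarrow> v x \<in> mono_ideal A Q"
    and cycle: "\<And>y. y \<in> X \<Longrightarrow> (\<Sum>x\<in>X. v x * d x y) = 0" "(\<Sum>x\<in>X. v x * e x) = 0"
  shows "\<exists>w. (\<forall>x\<in>X. w x \<in> mono_ideal A Q) \<and> (\<forall>y\<in>X. v y = (\<Sum>x\<in>X. w x * d x y))"
proof -
  \<comment> \<open>The component at \<open>\<tau>\<close> collects the terms whose part in
    \<open>D\<close> is exactly \<open>\<tau>\<close>; \<open>T\<close> lists the finitely many
    parts that occur in \<open>v\<close>.\<close>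
  let ?c = "\<lambda>\<tau>. part (\<lambda>t. part (\<lambda>j. j \<in> D) t = \<tau>)"
  define T where "T = (\<Union>x\<in>X. part (\<lambda>j. j \<in> D) ` Poly_Mapping.keys (v x))"
  have "finite T" unfolding T_def using \<open>finite X\<close> by simp
  \<comment> \<open>Factors free of \<open>D\<close> do not move a term to another
    component.\<close>
  have commute: "?c \<tau> (p * q) = ?c \<tau> p * q" if "avoids D q" for \<tau> and p q :: "('v, 'k) mpoly"
  proof -
    have "?c \<tau> (q * p) = q * ?c \<tau> p"
      by (rule part_mult_left)
        (use that in \<open>simp add: avoids_def part_add part_exponent_avoiding\<close>)
    then show ?thesis by (simp add: mult.commute)
  qed
  have "\<exists>w. (\<forall>x\<in>X. w x \<in> mono_ideal A Q) \<and> (\<forall>y\<in>X. ?c \<tau> (v y) = (\<Sum>x\<in>X. w x * d x y))"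
    if tau: "\<tau> \<in> T" for \<tau>
  proof -
    let ?m = "Poly_Mapping.single \<tau> 1 :: ('v, 'k) mpoly"
    obtain x0 t0 where x0: "x0 \<in> X" "t0 \<in> Poly_Mapping.keys (v x0)" "\<tau> = part (\<lambda>j. j \<in> D) t0"
      using tau unfolding T_def by blast
    \<comment> \<open>Here \<open>\<tau>\<close> is the part in \<open>D\<close> of a term of
      \<open>v\<close>, and \<open>Q\<close> sees nothing else of that term.\<close>
    have "Q \<tau>" using v[OF x0(1)] x0(2,3) Q(2) unfolding mono_ideal_def depends_on_def by blast
    moreover have "Poly_Mapping.keys \<tau> \<subseteq> A"
      using v[OF x0(1)] x0(2) unfolding mono_ideal_def by (auto simp: x0(3) keys_part poly_ring_simps)
    ultimately have m: "?m \<in> mono_ideal A Q" by (simp add: mono_ideal_def polys_single)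
    have "\<exists>q. ?c \<tau> (v x) = ?m * q \<and> q \<in> polys A \<and> avoids D q" if "x \<in> X" for x
    proof -
      have "\<exists>s. t = \<tau> + s" if "t \<in> Poly_Mapping.keys (?c \<tau> (v x))" for t
        using that part_partition[of D t] by (auto simp: keys_part intro: exI[of _ "part (\<lambda>j. j \<notin> D) t"])
      then obtain q where q: "?c \<tau> (v x) = ?m * q"
        "\<And>s. s \<in> Poly_Mapping.keys q \<Longrightarrow> \<tau> + s \<in> Poly_Mapping.keys (?c \<tau> (v x))"
        using single_mult_dvd[of "?c \<tau> (v x)" \<tau>] by blast
      have s: "Poly_Mapping.keys s \<subseteq> A \<and> Poly_Mapping.keys s \<inter> D = {}"
        if "s \<in> Poly_Mapping.keys q" for s
      proof -
        have t: "\<tau> + s \<in> Poly_Mapping.keys (v x)" "part (\<lambda>j. j \<in> D) (\<tau> + s) = \<tau>"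
          using q(2)[OF that] by (auto simp: keys_part)
        have "Poly_Mapping.lookup s j = 0" if "j \<in> D" for j
          using arg_cong[OF t(2), of "\<lambda>u. Poly_Mapping.lookup u j"] that
          by (simp add: lookup_part lookup_add)
        moreover have "Poly_Mapping.keys (\<tau> + s) \<subseteq> A"
          using t(1) v[OF \<open>x \<in> X\<close>] by (simp add: mono_ideal_def poly_ring_simps)
        then have "Poly_Mapping.keys s \<subseteq> A" by (simp add: keys_add_nat)
        ultimately show ?thesis by (auto simp: in_keys_iff)
      qed
      then show ?thesis using q(1) by (auto simp: avoids_def poly_ring_simps)
    qed
    then obtain q where q: "\<And>x. x \<in> X \<Longrightarrow> ?c \<tau> (v x) = ?m * q x"
      "\<And>x. x \<in> X \<Longrightarrow> q x \<in> polys A" "\<And>x. x \<in> X \<Longrightarrow> avoids D (q x)"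
      by metis
    \<comment> \<open>Dividing by the monomial keeps the relations, since it is a
      nonzerodivisor.\<close>
    have cyc: "(\<Sum>x\<in>X. q x * f x) = 0"
      if f: "\<And>x. x \<in> X \<Longrightarrow> avoids D (f x)" and 0: "(\<Sum>x\<in>X. v x * f x) = 0" for f
    proof -
      have "?m * (\<Sum>x\<in>X. q x * f x) = (\<Sum>x\<in>X. ?c \<tau> (v x * f x))"
        unfolding sum_distrib_left by (rule sum.cong) (simp_all add: commute f q(1) mult.assoc)
      also have "\<dots> = 0" by (simp add: part_sum[symmetric] 0)
      finally show ?thesis by (rule single_mult_eq_0D)
    qed
    have "\<exists>w. (\<forall>x\<in>X. w x \<in> polys A) \<and> (\<forall>y\<in>X. q y = (\<Sum>x\<in>X. w x * d x y))"
      using av cycle by (intro exact q cyc) (auto simp: avoiding_def)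
    then obtain w where w: "\<forall>x\<in>X. w x \<in> polys A" "\<forall>y\<in>X. q y = (\<Sum>x\<in>X. w x * d x y)" by blast
    \<comment> \<open>Multiplying the lift by \<open>\<tau>\<close>, which satisfies
      \<open>Q\<close>, brings it back into the ideal.\<close>
    show ?thesis
      using w q(1) mono_ideal_mult[OF Q(1) m]
      by (intro exI[of _ "\<lambda>x. ?m * w x"]) (auto simp: sum_distrib_left mult.assoc)
  qed
  then have "\<exists>w. \<forall>\<tau>\<in>T. (\<forall>x\<in>X. w \<tau> x \<in> mono_ideal A Q) \<and>
      (\<forall>y\<in>X. ?c \<tau> (v y) = (\<Sum>x\<in>X. w \<tau> x * d x y))"
    by (intro bchoice ballI)
  then obtain w where "\<forall>\<tau>\<in>T. (\<forall>x\<in>X. w \<tau> x \<in> mono_ideal A Q) \<and>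
      (\<forall>y\<in>X. ?c \<tau> (v y) = (\<Sum>x\<in>X. w \<tau> x * d x y))"
    by (elim exE)
  then have w: "\<And>\<tau> x. \<tau> \<in> T \<Longrightarrow> x \<in> X \<Longrightarrow> w \<tau> x \<in> mono_ideal A Q"
    "\<And>\<tau> y. \<tau> \<in> T \<Longrightarrow> y \<in> X \<Longrightarrow> ?c \<tau> (v y) = (\<Sum>x\<in>X. w \<tau> x * d x y)"
    by simp_all
  have "v y = (\<Sum>x\<in>X. (\<Sum>\<tau>\<in>T. w \<tau> x) * d x y)" if "y \<in> X" for y
  proof -
    have "(\<Sum>\<tau>\<in>T. ?c \<tau> (v y)) = v y"
    proof (rule poly_mapping_eqI)
      fix t
      have "(\<Sum>\<tau>\<in>T. Poly_Mapping.lookup (?c \<tau> (v y)) t) =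
          (if part (\<lambda>j. j \<in> D) t \<in> T then Poly_Mapping.lookup (v y) t else 0)"
        using \<open>finite T\<close> by (simp add: lookup_part)
      moreover have "part (\<lambda>j. j \<in> D) t \<in> T" if "t \<in> Poly_Mapping.keys (v y)"
        using that \<open>y \<in> X\<close> unfolding T_def by blast
      ultimately show "Poly_Mapping.lookup (\<Sum>\<tau>\<in>T. ?c \<tau> (v y)) t = Poly_Mapping.lookup (v y) t"
        by (auto simp: lookup_sum in_keys_iff)
    qed
    also have "(\<Sum>\<tau>\<in>T. ?c \<tau> (v y)) = (\<Sum>\<tau>\<in>T. \<Sum>x\<in>X. w \<tau> x * d x y)"
      using that w(2) by simp
    finally show ?thesis by (simp add: sum_distrib_right sum.swap[of _ T])
  qed
  then show ?thesis using w(1) by (intro exI[of _ "\<lambda>x. \<Sum>\<tau>\<in>T. w \<tau> x"]) (auto intro: mono_ideal_sum)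
qed

section \<open>Setting variables to zero\<close>

lemma span_sum:
  fixes e :: "'x \<Rightarrow> ('v, 'k::field) mpoly"
  assumes "\<And>t. t \<in> T \<Longrightarrow> \<exists>v. (\<forall>x\<in>X. v x \<in> polys A) \<and> f t = (\<Sum>x\<in>X. v x * e x)"
  shows "\<exists>v. (\<forall>x\<in>X. v x \<in> polys A) \<and> (\<Sum>t\<in>T. f t) = (\<Sum>x\<in>X. v x * e x)"
  using assms
proof (induction T rule: infinite_finite_induct)
  case (insert t T)
  have "\<exists>v. (\<forall>x\<in>X. v x \<in> polys A) \<and> f t = (\<Sum>x\<in>X. v x * e x)"
    by (rule insert.prems) simp
  then obtain v where "\<forall>x\<in>X. v x \<in> polys A" "f t = (\<Sum>x\<in>X. v x * e x)" by (elim exE conjE)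
  moreover have "\<exists>w. (\<forall>x\<in>X. w x \<in> polys A) \<and> (\<Sum>t\<in>T. f t) = (\<Sum>x\<in>X. w x * e x)"
    by (rule insert.IH, rule insert.prems) simp
  then obtain w where "\<forall>x\<in>X. w x \<in> polys A" "(\<Sum>t\<in>T. f t) = (\<Sum>x\<in>X. w x * e x)"
    by (elim exE conjE)
  ultimately show ?case using insert.hyps
    by (intro exI[of _ "\<lambda>x. v x + w x"]) (simp add: polys_add distrib_right sum.distrib)
qed (auto intro!: exI[of _ "\<lambda>_. 0"])

lemma mono_ideal_span:
  fixes e :: "'x \<Rightarrow> ('v, 'k::field) mpoly"
  assumes "\<And>t. P t \<Longrightarrow> Poly_Mapping.keys t \<subseteq> A \<Longrightarrow>
      \<exists>v. (\<forall>x\<in>X. v x \<in> polys A) \<and> Poly_Mapping.single t 1 = (\<Sum>x\<in>X. v x * e x)"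
    and p: "p \<in> mono_ideal A P"
  shows "\<exists>v. (\<forall>x\<in>X. v x \<in> polys A) \<and> p = (\<Sum>x\<in>X. v x * e x)"
proof -
  have "\<exists>v. (\<forall>x\<in>X. v x \<in> polys A) \<and>
      Poly_Mapping.single t (Poly_Mapping.lookup p t) = (\<Sum>x\<in>X. v x * e x)"
    if "t \<in> Poly_Mapping.keys p" for t
  proof -
    have "P t" "Poly_Mapping.keys t \<subseteq> A"
      using p that by (auto simp: mono_ideal_def poly_ring_simps)
    then obtain v where v: "\<forall>x\<in>X. v x \<in> polys A" "Poly_Mapping.single t 1 = (\<Sum>x\<in>X. v x * e x)"
      using assms(1) by blast
    let ?c = "Poly_Mapping.single 0 (Poly_Mapping.lookup p t) :: ('v, 'k) mpoly"
    have "?c * Poly_Mapping.single t 1 = (\<Sum>x\<in>X. (?c * v x) * e x)"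
      by (simp only: v(2) sum_distrib_left mult.assoc)
    then show ?thesis
      using v(1) by (intro exI[of _ "\<lambda>x. ?c * v x"]) (auto simp: mult_single intro!: polys_mult polys_single)
  qed
  then have "\<exists>v. (\<forall>x\<in>X. v x \<in> polys A) \<and>
      (\<Sum>t\<in>Poly_Mapping.keys p. Poly_Mapping.single t (Poly_Mapping.lookup p t)) = (\<Sum>x\<in>X. v x * e x)"
    by (rule span_sum)
  then show ?thesis by (simp only: poly_mapping_sum_singles)
qed

lemma depends_on_disjoint:
  fixes t :: "'v \<Rightarrow>\<^sub>0 nat"
  assumes "depends_on C P" "C \<inter> D = {}"
  shows "P (part (\<lambda>j. j \<notin> D) t) \<longleftrightarrow> P t"
proof -
  have "part (\<lambda>j. j \<in> C) (part (\<lambda>j. j \<notin> D) t) = part (\<lambda>j. j \<in> C) t"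
    by (rule poly_mapping_eqI) (use assms(2) in \<open>auto simp: lookup_part\<close>)
  then show ?thesis using assms(1) unfolding depends_on_def by metis
qed

lemma kill_decompose:
  fixes p :: "('v, 'k::field) mpoly"
  assumes "p \<in> polys A"
  shows "\<exists>q\<in>polys A. p = kill {j} p + Poly_Mapping.single (Poly_Mapping.single j 1) 1 * q"
proof -
  let ?s = "Poly_Mapping.single j (1::nat)"
  let ?p = "part (\<lambda>t. Poly_Mapping.keys t \<inter> {j} \<noteq> {}) p"
  have "\<exists>s. t = ?s + s" if "t \<in> Poly_Mapping.keys ?p" for t
  proof
    show "t = ?s + (t - ?s)"
      using that by (intro poly_mapping_eqI)
        (auto simp: keys_part lookup_add lookup_minus lookup_single when_def in_keys_iff)
  qed
  then obtain q where q: "?p = Poly_Mapping.single ?s 1 * q"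
    "\<And>s. s \<in> Poly_Mapping.keys q \<Longrightarrow> ?s + s \<in> Poly_Mapping.keys ?p"
    using single_mult_dvd[of ?p ?s] by blast
  have "Poly_Mapping.keys s \<subseteq> A" if "s \<in> Poly_Mapping.keys q" for s
  proof -
    have "?s + s \<in> Poly_Mapping.keys p" using q(2)[OF that] by (simp add: keys_part)
    then have "Poly_Mapping.keys (?s + s) \<subseteq> A" using assms by (simp add: poly_ring_simps)
    then show ?thesis by (simp add: keys_add_nat)
  qed
  then have "q \<in> polys A" by (simp add: poly_ring_simps)
  moreover have "p = kill {j} p + ?p"
    unfolding kill_def by (rule poly_mapping_eqI) (simp add: lookup_part lookup_add)
  ultimately show ?thesis using q(1) by metis
qed

text \<open>A variable on which the ideal does not depend is a nonzerodivisor on the ring and on its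
  quotient by the ideal, so that the resolution stays exact modulo this variable.\<close>

lemma (in linear_resolution) kill_variable:
  assumes P: "upward P" "depends_on C P" "j \<notin> C"
    and j: "j \<in> A"
  shows "linear_resolution A P r X h (\<lambda>x y. kill {j} (d x y)) (\<lambda>x. kill {j} (e x))"
proof
  let ?k = "kill {j} :: ('v, 'k) mpoly \<Rightarrow> ('v, 'k) mpoly"
  let ?m = "Poly_Mapping.single (Poly_Mapping.single j 1) 1 :: ('v, 'k) mpoly"
  have C: "C \<inter> {j} = {}" using P(3) by simp
  show "finite X" by (rule finite_X)
  show "?k (d x y) \<in> homogeneous A 1" if "x \<in> X" "y \<in> X" for x y
    using that by (intro homogeneous_kill d_homogeneous)
  show "h x = Suc (h y)" if "x \<in> X" "y \<in> X" "?k (d x y) \<noteq> 0" for x y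
    using that d_eq_0[of x y] by fastforce
  show "?k (e x) \<in> homogeneous A r" if "x \<in> X" for x
    using that by (intro homogeneous_kill e_homogeneous)
  show "h x = 0" if "x \<in> X" "?k (e x) \<noteq> 0" for x
    using that e_eq_0[of x] by fastforce
  show "(\<Sum>y\<in>X. ?k (d x y) * ?k (d y z)) = 0" if "x \<in> X" "z \<in> X" for x z
    using dd[OF that] by (simp flip: kill_mult kill_sum)
  show "(\<Sum>y\<in>X. ?k (d x y) * ?k (e y)) = 0" if "x \<in> X" for x
    using de[OF that] by (simp flip: kill_mult kill_sum)
  have top: "mono_ideal A (\<lambda>_. True) = (polys A :: ('v, 'k) mpoly set)"
    by (simp add: mono_ideal_def)
  have av: "avoiding {j} X (\<lambda>x y. ?k (d x y)) (\<lambda>x. ?k (e x))"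
    by (simp add: avoiding_def avoids_kill)
  \<comment> \<open>Vectors free of the variable come first; \<open>exact_on_mono_ideal\<close>,
    with the whole ring as ideal, then extends exactness to all vectors.\<close>
  have "\<exists>w. (\<forall>x\<in>X. w x \<in> polys A) \<and> (\<forall>y\<in>X. v y = (\<Sum>x\<in>X. w x * ?k (d x y)))"
    if v: "\<And>x. x \<in> X \<Longrightarrow> v x \<in> polys A" "\<And>x. x \<in> X \<Longrightarrow> avoids {j} (v x)"
      and cyc: "\<And>y. y \<in> X \<Longrightarrow> (\<Sum>x\<in>X. v x * ?k (d x y)) = 0" "(\<Sum>x\<in>X. v x * ?k (e x)) = 0" for v
  proof -
    define q where "q p = (SOME q. q \<in> polys A \<and> p = ?k p + ?m * q)" for p
    have q: "q p \<in> polys A \<and> p = ?k p + ?m * q p" if "p \<in> polys A" for p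
      unfolding q_def by (rule someI_ex) (use kill_decompose[OF that, of j] in blast)
    have split: "(\<Sum>x\<in>X. v x * f x) = (\<Sum>x\<in>X. v x * ?k (f x)) + ?m * (\<Sum>x\<in>X. v x * q (f x))"
      if "\<And>x. x \<in> X \<Longrightarrow> f x \<in> polys A" for f
    proof -
      have "v x * f x = v x * ?k (f x) + ?m * (v x * q (f x))" if "x \<in> X" for x
      proof -
        have "v x * f x = v x * (?k (f x) + ?m * q (f x))"
          using q[OF \<open>\<And>x. x \<in> X \<Longrightarrow> f x \<in> polys A\<close>[OF that]] by simp
        then show ?thesis by (simp add: algebra_simps)
      qed
      then show ?thesis by (simp add: sum.distrib sum_distrib_left)
    qed
    \<comment> \<open>The boundary and the augmentation of \<open>v\<close> vanish modulo the
      variable; \<open>w\<close> and \<open>g\<close> are what remains after dividing them by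
      it.\<close>
    define w where "w y = (\<Sum>x\<in>X. v x * q (d x y))" for y
    define g where "g = (\<Sum>x\<in>X. v x * q (e x))"
    have w: "(\<Sum>x\<in>X. v x * d x y) = ?m * w y" if "y \<in> X" for y
      using split[of "\<lambda>x. d x y"] cyc(1)[OF that] that by (simp add: w_def d_polys)
    have g: "(\<Sum>x\<in>X. v x * e x) = ?m * g"
      using split[of e] cyc(2) by (simp add: g_def e_polys)
    have w_polys: "w y \<in> polys A" if "y \<in> X" for y
      unfolding w_def using that v(1) q d_polys by (intro polys_sum polys_mult) auto
    \<comment> \<open>The variable is a nonzerodivisor on the ring, so \<open>w\<close> inherits the
      relations of a boundary.\<close>
    have w_cycle: "(\<Sum>y\<in>X. w y * f y) = 0"
      if "\<And>x. x \<in> X \<Longrightarrow> (\<Sum>y\<in>X. d x y * f y) = 0" for f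
    proof -
      have "?m * (\<Sum>y\<in>X. w y * f y) = (\<Sum>y\<in>X. (\<Sum>x\<in>X. v x * d x y) * f y)"
        by (simp add: sum_distrib_left w mult.assoc)
      also have "\<dots> = 0" by (rule cycle_comp) (rule that)
      finally show ?thesis by (rule single_mult_eq_0D)
    qed
    obtain w' where w': "\<And>x. x \<in> X \<Longrightarrow> w' x \<in> polys A"
      "\<And>y. y \<in> X \<Longrightarrow> w y = (\<Sum>x\<in>X. w' x * d x y)" "\<And>x. x \<in> X \<Longrightarrow> w' x * e x = 0"
      by (rule exact'[of w]) (auto intro: w_polys w_cycle dd de)
    have g_polys: "g \<in> polys A"
      unfolding g_def using v(1) q e_polys by (intro polys_sum polys_mult) auto
    \<comment> \<open>It is also a nonzerodivisor modulo the ideal, because \<open>P\<close> ignores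
      the exponent of \<open>j\<close>.\<close>
    have "P s" if "s \<in> Poly_Mapping.keys g" for s
    proof -
      have "?m * g \<in> mono_ideal A P" unfolding image g[symmetric] using v(1) by auto
      then have "P (Poly_Mapping.single j 1 + s)"
        using keys_single_mult[OF that] unfolding mono_ideal_def by blast
      moreover have "part (\<lambda>i. i \<notin> {j}) (Poly_Mapping.single j 1 + s) = part (\<lambda>i. i \<notin> {j}) s"
        by (rule poly_mapping_eqI) (simp add: lookup_part lookup_add lookup_single)
      ultimately show ?thesis using depends_on_disjoint[OF P(2) C] by metis
    qed
    then have "g \<in> mono_ideal A P" using g_polys by (simp add: mono_ideal_def)
    then obtain g' where g': "\<And>x. x \<in> X \<Longrightarrow> g' x \<in> polys A" "g = (\<Sum>x\<in>X. g' x * e x)"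
      "\<And>x y. x \<in> X \<Longrightarrow> y \<in> X \<Longrightarrow> g' x * d x y = 0"
      by (rule image') (rule that)
    have m: "?m \<in> polys A" using j by (simp add: polys_single)
    \<comment> \<open>\<open>w'\<close> corrects the boundary and has augmentation 0;
      \<open>g'\<close> corrects the augmentation and has boundary 0. The result is a cycle already
      before the substitution, and it agrees with \<open>v\<close> modulo the variable.\<close>
    define z where "z x = v x - ?m * (w' x + g' x)" for x
    have z_sum: "(\<Sum>x\<in>X. z x * f x) =
        (\<Sum>x\<in>X. v x * f x) - ?m * ((\<Sum>x\<in>X. w' x * f x) + (\<Sum>x\<in>X. g' x * f x))" for f
      by (simp add: z_def algebra_simps sum.distrib sum_subtractf sum_distrib_left)
    have "\<exists>u. (\<forall>x\<in>X. u x \<in> polys A) \<and> (\<forall>y\<in>X. z y = (\<Sum>x\<in>X. u x * d x y))"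
    proof (rule exact)
      show "z x \<in> polys A" if "x \<in> X" for x
        unfolding z_def using that m v(1) w'(1) g'(1) by (intro polys_diff polys_mult polys_add) auto
      show "(\<Sum>x\<in>X. z x * d x y) = 0" if "y \<in> X" for y
        using that by (simp add: z_sum w g'(3) flip: w'(2))
      show "(\<Sum>x\<in>X. z x * e x) = 0"
        by (simp add: z_sum g w'(3) flip: g'(2))
    qed
    then obtain u where u: "\<forall>x\<in>X. u x \<in> polys A" "\<forall>y\<in>X. z y = (\<Sum>x\<in>X. u x * d x y)" by blast
    have km: "?k ?m = 0" by (simp add: kill_def part_single)
    have "v y = (\<Sum>x\<in>X. ?k (u x) * ?k (d x y))" if "y \<in> X" for y
    proof -
      have "v y = ?k (v y)" using v(2)[OF that] by (simp add: kill_id)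
      also have "\<dots> = ?k (z y + ?m * (w' y + g' y))" by (simp add: z_def)
      also have "\<dots> = ?k (z y) + ?k ?m * ?k (w' y + g' y)"
        by (simp only: kill_mult[symmetric]) (simp only: kill_def part_add)
      also have "\<dots> = ?k (z y)" by (simp only: km mult_zero_left add_0_right)
      also have "\<dots> = (\<Sum>x\<in>X. ?k (u x) * ?k (d x y))"
        using u(2) that by (simp add: kill_sum kill_mult)
      finally show ?thesis .
    qed
    then show ?thesis using u(1) by (intro exI[of _ "\<lambda>x. ?k (u x)"]) (simp add: polys_kill)
  qed
  note reduced_exact = this
  show "\<exists>w. (\<forall>x\<in>X. w x \<in> polys A) \<and> (\<forall>y\<in>X. v y = (\<Sum>x\<in>X. w x * ?k (d x y)))"
    if "\<And>x. x \<in> X \<Longrightarrow> v x \<in> polys A" "\<And>y. y \<in> X \<Longrightarrow> (\<Sum>x\<in>X. v x * ?k (d x y)) = 0"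
      "(\<Sum>x\<in>X. v x * ?k (e x)) = 0" for v
    by (rule exact_on_mono_ideal[OF finite_X av reduced_exact, where Q = "\<lambda>_. True", unfolded top])
      (auto simp: upward_def depends_on_def that)
  show "p \<in> mono_ideal A P \<longleftrightarrow> (\<exists>v. (\<forall>x\<in>X. v x \<in> polys A) \<and> p = (\<Sum>x\<in>X. v x * ?k (e x)))" for p
  proof
    assume "\<exists>v. (\<forall>x\<in>X. v x \<in> polys A) \<and> p = (\<Sum>x\<in>X. v x * ?k (e x))"
    then obtain v where v: "\<forall>x\<in>X. v x \<in> polys A" "p = (\<Sum>x\<in>X. v x * ?k (e x))" by blast
    have "?k (e x) * v x \<in> mono_ideal A P" if "x \<in> X" for x
      using that v(1) by (intro mono_ideal_mult P(1))
        (auto simp: kill_def intro: mono_ideal_part e_mono_ideal)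
    then show "p \<in> mono_ideal A P"
      unfolding v(2) by (intro mono_ideal_sum) (simp add: mult.commute)
  next
    assume p: "p \<in> mono_ideal A P"
    show "\<exists>v. (\<forall>x\<in>X. v x \<in> polys A) \<and> p = (\<Sum>x\<in>X. v x * ?k (e x))"
    proof (rule mono_ideal_span[OF _ p])
      fix t :: "'v \<Rightarrow>\<^sub>0 nat" assume t: "P t" "Poly_Mapping.keys t \<subseteq> A"
      \<comment> \<open>Substituting in an expression for \<open>t\<close> itself could give 0. So
        the power of the variable is split off first and multiplied back afterwards.\<close>
      let ?\<tau> = "part (\<lambda>i. i \<in> {j}) t" and ?s = "part (\<lambda>i. i \<notin> {j}) t"
      have "P ?s" using t(1) depends_on_disjoint[OF P(2) C] by blast
      then have "Poly_Mapping.single ?s (1 :: 'k) \<in> mono_ideal A P"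
        using t(2) by (auto simp: mono_ideal_def keys_part intro!: polys_single)
      then obtain v where v: "\<forall>x\<in>X. v x \<in> polys A"
        "Poly_Mapping.single ?s (1 :: 'k) = (\<Sum>x\<in>X. v x * e x)"
        unfolding image by blast
      have "Poly_Mapping.keys ?s \<inter> {j} = {}" by (auto simp: keys_part)
      then have "Poly_Mapping.single ?s (1 :: 'k) = ?k (Poly_Mapping.single ?s 1)"
        by (simp add: kill_def part_single)
      also have "\<dots> = (\<Sum>x\<in>X. ?k (v x) * ?k (e x))" by (simp only: v(2) kill_sum kill_mult)
      finally have "Poly_Mapping.single ?\<tau> 1 * Poly_Mapping.single ?s (1 :: 'k) =
          (\<Sum>x\<in>X. (Poly_Mapping.single ?\<tau> 1 * ?k (v x)) * ?k (e x))"
        by (simp only: sum_distrib_left mult.assoc)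
      moreover have "Poly_Mapping.single ?\<tau> 1 * Poly_Mapping.single ?s (1 :: 'k) = Poly_Mapping.single t 1"
        unfolding mult_single part_partition by simp
      moreover have "Poly_Mapping.single ?\<tau> 1 * ?k (v x) \<in> polys A" if "x \<in> X" for x
        using v(1) t(2) that by (intro polys_mult polys_single polys_kill) (auto simp: keys_part)
      ultimately show "\<exists>v. (\<forall>x\<in>X. v x \<in> polys A) \<and> Poly_Mapping.single t 1 = (\<Sum>x\<in>X. v x * ?k (e x))"
        by (intro exI[of _ "\<lambda>x. Poly_Mapping.single ?\<tau> 1 * ?k (v x)"]) simp
    qed
  qed
qed

lemma linear_resolution_avoiding:
  fixes d :: "'x \<Rightarrow> 'x \<Rightarrow> ('v, 'k::field) mpoly" and e :: "'x \<Rightarrow> ('v, 'k) mpoly"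
  assumes "finite D" "D \<subseteq> A" "D \<inter> C = {}" "upward P" "depends_on C P"
    and "linear_resolution A P r X h d e"
  shows "\<exists>(d' :: 'x \<Rightarrow> 'x \<Rightarrow> ('v, 'k) mpoly) e'.
    linear_resolution A P r X h d' e' \<and> avoiding D X d' e'"
  using assms(1-3)
proof (induction D rule: finite_induct)
  case empty
  show ?case using assms(6) by (intro exI[of _ d] exI[of _ e]) (simp add: avoiding_def avoids_def)
next
  case (insert j D)
  then obtain d' :: "'x \<Rightarrow> 'x \<Rightarrow> ('v, 'k) mpoly" and e' where d': "linear_resolution A P r X h d' e'" "avoiding D X d' e'" by auto
  let ?d = "\<lambda>x y. kill {j} (d' x y)" and ?e = "\<lambda>x. kill {j} (e' x)"
  have "linear_resolution A P r X h ?d ?e"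
    by (rule linear_resolution.kill_variable[OF d'(1) assms(4,5)]) (use insert.prems in auto)
  \<comment> \<open>Substitution only deletes terms, so variables removed earlier do not
    return.\<close>
  moreover have "avoids (insert j D) (kill {j} p)" if "avoids D p" for p :: "('v, 'k) mpoly"
    using avoids_kill[of "{j}" p] avoids_kill_other[OF that, of "{j}"] by (auto simp: avoids_def)
  then have "avoiding (insert j D) X ?d ?e"
    using d'(2) by (simp add: avoiding_def)
  ultimately show ?case by (intro exI conjI)
qed

section \<open>Tensor products of linear resolutions\<close>

text \<open>The total differential of the tensor product, with the usual sign on the second factor;
  the source is the first argument \<open>p\<close>.\<close>

definition tensor_d ::
    "('x \<Rightarrow> nat) \<Rightarrow> ('x \<Rightarrow> 'x \<Rightarrow> 'a::comm_ring_1) \<Rightarrow> ('y \<Rightarrow> 'y \<Rightarrow> 'a) \<Rightarrow> 'x \<times> 'y \<Rightarrow> 'x \<times> 'y \<Rightarrow> 'a" where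
  "tensor_d h d d' p q =
     (if snd p = snd q then d (fst p) (fst q) else 0) +
     (if fst p = fst q then (- 1) ^ h (fst p) * d' (snd p) (snd q) else 0)"

lemma tensor_boundary:
  assumes "finite X" "finite Y" "x \<in> X" "y \<in> Y"
  shows "(\<Sum>p\<in>X \<times> Y. w p * tensor_d h d d' p (x, y)) =
    (\<Sum>a\<in>X. w (a, y) * d a x) + (- 1) ^ h x * (\<Sum>b\<in>Y. w (x, b) * d' b y)"
proof -
  have "(\<Sum>p\<in>X \<times> Y. w p * tensor_d h d d' p (x, y)) =
      (\<Sum>a\<in>X. \<Sum>b\<in>Y. w (a, b) * tensor_d h d d' (a, b) (x, y))"
    by (simp add: sum.cartesian_product)
  also have "\<dots> = (\<Sum>a\<in>X. \<Sum>b\<in>Y. (if b = y then w (a, b) * d a x else 0) +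
      (if a = x then (- 1) ^ h x * (w (a, b) * d' b y) else 0))"
    by (intro sum.cong) (auto simp: tensor_d_def algebra_simps)
  also have "\<dots> = (\<Sum>a\<in>X. \<Sum>b\<in>Y. if b = y then w (a, b) * d a x else 0) +
      (\<Sum>a\<in>X. \<Sum>b\<in>Y. if a = x then (- 1) ^ h x * (w (a, b) * d' b y) else 0)"
    by (simp only: sum.distrib)
  also have "(\<Sum>a\<in>X. \<Sum>b\<in>Y. if b = y then w (a, b) * d a x else 0) = (\<Sum>a\<in>X. w (a, y) * d a x)"
    using assms by simp
  also have "(\<Sum>a\<in>X. \<Sum>b\<in>Y. if a = x then (- 1) ^ h x * (w (a, b) * d' b y) else 0) =
      (\<Sum>b\<in>Y. \<Sum>a\<in>X. if a = x then (- 1) ^ h x * (w (a, b) * d' b y) else 0)"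
    by (rule sum.swap)
  also have "\<dots> = (- 1) ^ h x * (\<Sum>b\<in>Y. w (x, b) * d' b y)"
    using assms by (simp add: sum_distrib_left)
  finally show ?thesis .
qed

text \<open>The roles differ: the matrices of the second factor avoid the variables \<open>D\<close>
  that decide \<open>P\<close>, the ideal of the first.\<close>

locale tensor_resolution =
  F: linear_resolution A P r X h d e + G: linear_resolution A P' r' Y h' d' e'
  for A :: "'v set" and P r and X :: "'x set" and h and d :: "'x \<Rightarrow> 'x \<Rightarrow> ('v, 'k::field) mpoly" and e
    and P' r' and Y :: "'y set" and h' and d' :: "'y \<Rightarrow> 'y \<Rightarrow> ('v, 'k) mpoly" and e' +
  fixes D C
  assumes avoiding: "avoiding D Y d' e'"
    and P: "upward P" "depends_on D P"
    and P': "upward P'" "depends_on C P'"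
    and disjoint: "C \<inter> D = {}"
begin

abbreviation "\<delta> \<equiv> tensor_d h d d'"
abbreviation "\<epsilon> \<equiv> \<lambda>p. e (fst p) * e' (snd p)"

lemmas boundary = tensor_boundary[OF F.finite_X G.finite_X]

lemma augmentation: "(\<Sum>p\<in>X \<times> Y. v p * \<epsilon> p) = (\<Sum>y\<in>Y. (\<Sum>x\<in>X. v (x, y) * e x) * e' y)"
proof -
  have "(\<Sum>p\<in>X \<times> Y. v p * \<epsilon> p) = (\<Sum>x\<in>X. \<Sum>y\<in>Y. v (x, y) * (e x * e' y))"
    by (simp add: sum.cartesian_product split_def)
  also have "\<dots> = (\<Sum>y\<in>Y. \<Sum>x\<in>X. v (x, y) * (e x * e' y))" by (rule sum.swap)
  finally show ?thesis by (simp add: sum_distrib_right mult.assoc)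
qed

text \<open>The augmentation lives in homological degree 0, where the sign is 1.\<close>

lemma sign_e: "x \<in> X \<Longrightarrow> (- 1) ^ h x * e x = e x"
  using F.e_eq_0[of x] by (cases "h x = 0") auto

text \<open>Augmenting all columns is a chain map to the second complex with coefficients in the
  first ideal: the column part of the boundary dies under \<open>e\<close>, and the sign disappears
  by \<open>sign_e\<close>.\<close>

lemma column_augmentation_boundary:
  assumes "y \<in> Y"
  shows "(\<Sum>x\<in>X. (\<Sum>p\<in>X \<times> Y. w p * \<delta> p (x, y)) * e x) =
    (\<Sum>b\<in>Y. (\<Sum>x\<in>X. w (x, b) * e x) * d' b y)"
proof -
  have "(\<Sum>x\<in>X. (\<Sum>p\<in>X \<times> Y. w p * \<delta> p (x, y)) * e x) =
      (\<Sum>x\<in>X. (\<Sum>a\<in>X. w (a, y) * d a x) * e x + (\<Sum>b\<in>Y. w (x, b) * d' b y) * e x)"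
  proof (rule sum.cong)
    fix x assume x: "x \<in> X"
    have "((- 1) ^ h x * (\<Sum>b\<in>Y. w (x, b) * d' b y)) * e x = (\<Sum>b\<in>Y. w (x, b) * d' b y) * ((- 1) ^ h x * e x)"
      by (simp only: ac_simps)
    then show "(\<Sum>p\<in>X \<times> Y. w p * \<delta> p (x, y)) * e x =
        (\<Sum>a\<in>X. w (a, y) * d a x) * e x + (\<Sum>b\<in>Y. w (x, b) * d' b y) * e x"
      by (simp only: boundary[OF x assms] distrib_right sign_e[OF x])
  qed simp
  also have "\<dots> = (\<Sum>x\<in>X. (\<Sum>a\<in>X. w (a, y) * d a x) * e x) + (\<Sum>x\<in>X. (\<Sum>b\<in>Y. w (x, b) * d' b y) * e x)"
    by (rule sum.distrib)
  also have "(\<Sum>x\<in>X. (\<Sum>a\<in>X. w (a, y) * d a x) * e x) = 0"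
    by (rule cycle_comp) (rule F.de)
  also have "(\<Sum>x\<in>X. (\<Sum>b\<in>Y. w (x, b) * d' b y) * e x) = (\<Sum>x\<in>X. \<Sum>b\<in>Y. w (x, b) * e x * d' b y)"
    by (simp add: sum_distrib_right mult.assoc mult.commute[of "d' _ y"])
  also have "\<dots> = (\<Sum>b\<in>Y. \<Sum>x\<in>X. w (x, b) * e x * d' b y)" by (rule sum.swap)
  finally show ?thesis by (simp add: sum_distrib_right)
qed

lemma \<delta>_polys: "p \<in> X \<times> Y \<Longrightarrow> q \<in> X \<times> Y \<Longrightarrow> \<delta> p q \<in> polys A"
  unfolding tensor_d_def using F.d_polys G.d_polys
  by (intro polys_add) (auto intro: polys_mult polys_sign)

lemma tensor_dd:
  assumes "p \<in> X \<times> Y" "q \<in> X \<times> Y"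
  shows "(\<Sum>s\<in>X \<times> Y. \<delta> p s * \<delta> s q) = 0"
proof -
  obtain a b x y where pq: "p = (a, b)" "q = (x, y)" and ab: "a \<in> X" "b \<in> Y" "x \<in> X" "y \<in> Y"
    using assms by auto
  have "(\<Sum>s\<in>X. \<delta> (a, b) (s, y) * d s x) =
      (\<Sum>s\<in>X. (if b = y then d a s * d s x else 0) + (if a = s then (- 1) ^ h a * d' b y * d s x else 0))"
    by (intro sum.cong) (auto simp: tensor_d_def distrib_right)
  also have "\<dots> = (- 1) ^ h a * d' b y * d a x"
    using ab F.finite_X by (cases "b = y") (simp_all add: sum.distrib F.dd)
  finally have 1: "(\<Sum>s\<in>X. \<delta> (a, b) (s, y) * d s x) = (- 1) ^ h a * d' b y * d a x" .
  have "(\<Sum>s\<in>Y. \<delta> (a, b) (x, s) * d' s y) =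
      (\<Sum>s\<in>Y. (if b = s then d a x * d' s y else 0) + (if a = x then (- 1) ^ h a * (d' b s * d' s y) else 0))"
    by (intro sum.cong) (auto simp: tensor_d_def distrib_right mult.assoc)
  also have "\<dots> = d a x * d' b y"
    using ab G.finite_X by (cases "a = x") (simp_all add: sum.distrib G.dd flip: sum_distrib_left)
  finally have 2: "(\<Sum>s\<in>Y. \<delta> (a, b) (x, s) * d' s y) = d a x * d' b y" .
  \<comment> \<open>An entry \<open>d a x\<close> is nonzero only for
    \<open>h a = Suc (h x)\<close>, and then the two signs are opposite.\<close>
  have "(- 1) ^ h a * d' b y * d a x + (- 1) ^ h x * (d a x * d' b y) = 0"
    using F.d_eq_0[OF ab(1,3)] by (cases "h a = Suc (h x)") (auto simp: ac_simps)
  then show ?thesis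
    unfolding pq boundary[OF ab(3,4)] 1 2 .
qed

text \<open>A cycle whose columns all augment to \<open>0\<close> is reduced to \<open>0\<close> by boundaries, starting from the
  columns of the highest degree.\<close>

lemma exact_zero_columns:
  assumes "\<And>p. p \<in> X \<times> Y \<Longrightarrow> v p \<in> polys A"
    and "\<And>q. q \<in> X \<times> Y \<Longrightarrow> (\<Sum>p\<in>X \<times> Y. v p * \<delta> p q) = 0"
    and "\<And>y. y \<in> Y \<Longrightarrow> (\<Sum>x\<in>X. v (x, y) * e x) = 0"
    and "\<And>x y. x \<in> X \<Longrightarrow> y \<in> Y \<Longrightarrow> N \<le> h' y \<Longrightarrow> v (x, y) = 0"
  shows "\<exists>w. (\<forall>p\<in>X \<times> Y. w p \<in> polys A) \<and> (\<forall>q\<in>X \<times> Y. v q = (\<Sum>p\<in>X \<times> Y. w p * \<delta> p q))"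
  using assms
proof (induction N arbitrary: v)
  case 0
  then show ?case by (intro exI[of _ "\<lambda>_. 0"]) auto
next
  case (Suc N)
  note v = Suc.prems
  \<comment> \<open>No row part of the boundary arrives in the top degree \<open>N\<close>, because
    \<open>v\<close> is 0 at its sources, in degree \<open>Suc N\<close>. So each column of degree
    \<open>N\<close> is a cycle of the first complex.\<close>
  have "\<exists>u. (\<forall>x\<in>X. u x \<in> polys A) \<and> (\<forall>x\<in>X. v (x, y) = (\<Sum>a\<in>X. u a * d a x)) \<and> (\<forall>x\<in>X. u x * e x = 0)"
    if y: "y \<in> Y" "h' y = N" for y
  proof -
    have cols: "(\<Sum>a\<in>X. v (a, y) * d a x) = 0" if x: "x \<in> X" for x
    proof -
      have "v (x, b) * d' b y = 0" if "b \<in> Y" for b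
        using v(4)[OF x that] G.d_eq_0[OF that y(1)] y(2) by (cases "h' b = Suc N") auto
      then have "(\<Sum>b\<in>Y. v (x, b) * d' b y) = 0" by simp
      then show ?thesis using v(2)[of "(x, y)"] x y(1) by (simp add: boundary)
    qed
    obtain u where "\<And>x. x \<in> X \<Longrightarrow> u x \<in> polys A"
      "\<And>x. x \<in> X \<Longrightarrow> v (x, y) = (\<Sum>a\<in>X. u a * d a x)" "\<And>x. x \<in> X \<Longrightarrow> u x * e x = 0"
      by (rule F.exact'[of "\<lambda>x. v (x, y)"]) (auto intro: v(1,3) y(1) cols)
    then show ?thesis by (intro exI[of _ u]) simp
  qed
  then have "\<forall>y\<in>{y\<in>Y. h' y = N}. \<exists>u. (\<forall>x\<in>X. u x \<in> polys A) \<and>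
      (\<forall>x\<in>X. v (x, y) = (\<Sum>a\<in>X. u a * d a x)) \<and> (\<forall>x\<in>X. u x * e x = 0)"
    by simp
  from bchoice[OF this] obtain u where u: "\<forall>y\<in>{y\<in>Y. h' y = N}. (\<forall>x\<in>X. u y x \<in> polys A) \<and>
      (\<forall>x\<in>X. v (x, y) = (\<Sum>a\<in>X. u y a * d a x)) \<and> (\<forall>x\<in>X. u y x * e x = 0)"
    by (elim exE)
  \<comment> \<open>These lifts are annihilated by \<open>e\<close> entrywise, so removing their
    boundary preserves the condition on the columns.\<close>
  define w where "w p = (if h' (snd p) = N then u (snd p) (fst p) else 0)" for p
  define v' where "v' q = v q - (\<Sum>p\<in>X \<times> Y. w p * \<delta> p q)" for q
  have w_polys: "w p \<in> polys A" if "p \<in> X \<times> Y" for p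
    using u that by (auto simp: w_def)
  have w_e: "w (x, y) * e x = 0" if "x \<in> X" "y \<in> Y" for x y
    using u that by (simp add: w_def)
  have "\<exists>w. (\<forall>p\<in>X \<times> Y. w p \<in> polys A) \<and> (\<forall>q\<in>X \<times> Y. v' q = (\<Sum>p\<in>X \<times> Y. w p * \<delta> p q))"
  proof (rule Suc.IH)
    show "v' q \<in> polys A" if "q \<in> X \<times> Y" for q
      unfolding v'_def using that v(1) w_polys \<delta>_polys by (intro polys_diff polys_sum polys_mult) auto
    show "(\<Sum>p\<in>X \<times> Y. v' p * \<delta> p q) = 0" if "q \<in> X \<times> Y" for q
    proof -
      have "(\<Sum>p\<in>X \<times> Y. (\<Sum>s\<in>X \<times> Y. w s * \<delta> s p) * \<delta> p q) = 0"
        by (rule cycle_comp) (rule tensor_dd[OF _ that])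
      then show ?thesis using v(2)[OF that] by (simp add: v'_def left_diff_distrib sum_subtractf)
    qed
    show "(\<Sum>x\<in>X. v' (x, y) * e x) = 0" if "y \<in> Y" for y
      using that v(3)[OF that] by (simp add: v'_def left_diff_distrib sum_subtractf column_augmentation_boundary w_e)
    \<comment> \<open>At \<open>h' y = N\<close> the column part reproduces \<open>v\<close>, and
      above \<open>N\<close> both vanish; the row part of this boundary lands below
      \<open>N\<close>.\<close>
    show "v' (x, y) = 0" if "x \<in> X" "y \<in> Y" "N \<le> h' y" for x y
    proof -
      have "w (x, b) * d' b y = 0" if "b \<in> Y" for b
        using G.d_eq_0[OF that \<open>y \<in> Y\<close>] \<open>N \<le> h' y\<close> by (cases "h' b = N") (auto simp: w_def)
      then have "(\<Sum>b\<in>Y. w (x, b) * d' b y) = 0" by simp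
      moreover have "(\<Sum>a\<in>X. w (a, y) * d a x) = v (x, y)"
        using u v(4)[OF that(1,2)] that by (cases "h' y = N") (auto simp: w_def)
      ultimately show ?thesis by (simp add: v'_def boundary[OF that(1,2)])
    qed
  qed
  then obtain w' where w': "\<forall>p\<in>X \<times> Y. w' p \<in> polys A" "\<forall>q\<in>X \<times> Y. v' q = (\<Sum>p\<in>X \<times> Y. w' p * \<delta> p q)"
    by (elim exE conjE)
  have "v q = (\<Sum>p\<in>X \<times> Y. (w p + w' p) * \<delta> p q)" if "q \<in> X \<times> Y" for q
    using bspec[OF w'(2) that] by (simp add: v'_def distrib_right sum.distrib algebra_simps)
  then show ?case using w'(1) w_polys by (intro exI[of _ "\<lambda>p. w p + w' p"]) (auto intro: polys_add)
qed

text \<open>Here \<open>avoiding\<close> is spent: coefficients in an ideal do not preserve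
  exactness in general, but they do when the matrices avoid the variables that decide the
  ideal.\<close>

lemma exact_columns:
  assumes v: "\<And>y. y \<in> Y \<Longrightarrow> v y \<in> mono_ideal A P"
    and cycle: "\<And>y. y \<in> Y \<Longrightarrow> (\<Sum>b\<in>Y. v b * d' b y) = 0" "(\<Sum>y\<in>Y. v y * e' y) = 0"
  shows "\<exists>w. (\<forall>y\<in>Y. w y \<in> mono_ideal A P) \<and> (\<forall>y\<in>Y. v y = (\<Sum>b\<in>Y. w b * d' b y))"
  by (rule exact_on_mono_ideal[OF G.finite_X avoiding _ P]) (auto intro: G.exact assms)

lemma tensor_exact:
  assumes v: "\<And>p. p \<in> X \<times> Y \<Longrightarrow> v p \<in> polys A"
    and cycle: "\<And>q. q \<in> X \<times> Y \<Longrightarrow> (\<Sum>p\<in>X \<times> Y. v p * \<delta> p q) = 0"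
    and aug: "(\<Sum>p\<in>X \<times> Y. v p * \<epsilon> p) = 0"
  shows "\<exists>w. (\<forall>p\<in>X \<times> Y. w p \<in> polys A) \<and> (\<forall>q\<in>X \<times> Y. v q = (\<Sum>p\<in>X \<times> Y. w p * \<delta> p q))"
proof -
  define u where "u y = (\<Sum>x\<in>X. v (x, y) * e x)" for y
  have "\<exists>u'. (\<forall>y\<in>Y. u' y \<in> mono_ideal A P) \<and> (\<forall>y\<in>Y. u y = (\<Sum>b\<in>Y. u' b * d' b y))"
  proof (rule exact_columns)
    show "u y \<in> mono_ideal A P" if "y \<in> Y" for y
      unfolding F.image u_def using v that by (intro exI[of _ "\<lambda>x. v (x, y)"]) auto
    show "(\<Sum>b\<in>Y. u b * d' b y) = 0" if "y \<in> Y" for y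
      unfolding u_def using column_augmentation_boundary[OF that, of v] cycle that by simp
    show "(\<Sum>y\<in>Y. u y * e' y) = 0" using aug unfolding augmentation u_def .
  qed
  then obtain u' where u': "\<forall>y\<in>Y. u' y \<in> mono_ideal A P" "\<forall>y\<in>Y. u y = (\<Sum>b\<in>Y. u' b * d' b y)"
    by (elim exE conjE)
  have "\<forall>y\<in>Y. \<exists>w. (\<forall>x\<in>X. w x \<in> polys A) \<and> u' y = (\<Sum>x\<in>X. w x * e x)"
    using u'(1) unfolding F.image .
  from bchoice[OF this] obtain w where
    w: "\<forall>y\<in>Y. (\<forall>x\<in>X. w y x \<in> polys A) \<and> u' y = (\<Sum>x\<in>X. w y x * e x)"
    by (elim exE)
  \<comment> \<open>The boundary of the lifted \<open>w\<close> has the same column augmentations as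
    \<open>v\<close>, so the difference augments to 0 in each column.\<close>
  define v' where "v' q = v q - (\<Sum>p\<in>X \<times> Y. w (snd p) (fst p) * \<delta> p q)" for q
  have "\<exists>w'. (\<forall>p\<in>X \<times> Y. w' p \<in> polys A) \<and> (\<forall>q\<in>X \<times> Y. v' q = (\<Sum>p\<in>X \<times> Y. w' p * \<delta> p q))"
  proof (rule exact_zero_columns)
    show "v' q \<in> polys A" if "q \<in> X \<times> Y" for q
      unfolding v'_def using that v w \<delta>_polys by (intro polys_diff polys_sum polys_mult) auto
    show "(\<Sum>p\<in>X \<times> Y. v' p * \<delta> p q) = 0" if "q \<in> X \<times> Y" for q
    proof -
      have "(\<Sum>p\<in>X \<times> Y. (\<Sum>s\<in>X \<times> Y. w (snd s) (fst s) * \<delta> s p) * \<delta> p q) = 0"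
        by (rule cycle_comp) (rule tensor_dd[OF _ that])
      then show ?thesis using cycle[OF that] by (simp add: v'_def left_diff_distrib sum_subtractf)
    qed
    show "(\<Sum>x\<in>X. v' (x, y) * e x) = 0" if "y \<in> Y" for y
    proof -
      have "(\<Sum>x\<in>X. (\<Sum>p\<in>X \<times> Y. w (snd p) (fst p) * \<delta> p (x, y)) * e x) = (\<Sum>b\<in>Y. u' b * d' b y)"
        using w by (simp add: column_augmentation_boundary[OF that, of "\<lambda>p. w (snd p) (fst p)"])
      then show ?thesis using u'(2) that by (simp add: v'_def left_diff_distrib sum_subtractf u_def)
    qed
    \<comment> \<open>No column reaches this degree, so the descent starts from a void
      condition.\<close>
    show "v' (x, y) = 0" if "x \<in> X" "y \<in> Y" "Suc (Max (h' ` Y)) \<le> h' y" for x y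
    proof -
      have "h' y \<le> Max (h' ` Y)" using that(2) G.finite_X by (intro Max_ge) auto
      then show ?thesis using that(3) by simp
    qed
  qed
  then obtain w' where w': "\<forall>p\<in>X \<times> Y. w' p \<in> polys A" "\<forall>q\<in>X \<times> Y. v' q = (\<Sum>p\<in>X \<times> Y. w' p * \<delta> p q)"
    by (elim exE conjE)
  have "v q = (\<Sum>p\<in>X \<times> Y. (w (snd p) (fst p) + w' p) * \<delta> p q)" if "q \<in> X \<times> Y" for q
    using bspec[OF w'(2) that] by (simp add: v'_def distrib_right sum.distrib algebra_simps)
  then show ?thesis
    using w'(1) w by (intro exI[of _ "\<lambda>p. w (snd p) (fst p) + w' p"]) (auto intro: polys_add)
qed

text \<open>In disjoint sets of variables, intersection equals product: the part of \<open>t\<close>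
  in \<open>D\<close> lies in the first ideal and the remaining factor in the second.\<close>

lemma tensor_image:
  "p \<in> mono_ideal A (\<lambda>t. P t \<and> P' t) \<longleftrightarrow>
    (\<exists>v. (\<forall>q\<in>X \<times> Y. v q \<in> polys A) \<and> p = (\<Sum>q\<in>X \<times> Y. v q * \<epsilon> q))"
proof
  assume "\<exists>v. (\<forall>q\<in>X \<times> Y. v q \<in> polys A) \<and> p = (\<Sum>q\<in>X \<times> Y. v q * \<epsilon> q)"
  then obtain v where v: "\<forall>q\<in>X \<times> Y. v q \<in> polys A" "p = (\<Sum>q\<in>X \<times> Y. v q * \<epsilon> q)" by (elim exE conjE)
  have "v q * \<epsilon> q \<in> mono_ideal A P" if "q \<in> X \<times> Y" for q
  proof -
    have "e (fst q) * (e' (snd q) * v q) \<in> mono_ideal A P"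
      using that v(1) by (intro mono_ideal_mult P(1) F.e_mono_ideal polys_mult G.e_polys) auto
    then show ?thesis by (simp add: ac_simps)
  qed
  then have 1: "p \<in> mono_ideal A P" unfolding v(2) by (rule mono_ideal_sum)
  have "v q * \<epsilon> q \<in> mono_ideal A P'" if "q \<in> X \<times> Y" for q
  proof -
    have "e' (snd q) * (e (fst q) * v q) \<in> mono_ideal A P'"
      using that v(1) by (intro mono_ideal_mult P'(1) G.e_mono_ideal polys_mult F.e_polys) auto
    then show ?thesis by (simp add: ac_simps)
  qed
  then have "p \<in> mono_ideal A P'" unfolding v(2) by (rule mono_ideal_sum)
  with 1 show "p \<in> mono_ideal A (\<lambda>t. P t \<and> P' t)" by (simp add: mono_ideal_def)
next
  assume p: "p \<in> mono_ideal A (\<lambda>t. P t \<and> P' t)"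
  show "\<exists>v. (\<forall>q\<in>X \<times> Y. v q \<in> polys A) \<and> p = (\<Sum>q\<in>X \<times> Y. v q * \<epsilon> q)"
  proof (rule mono_ideal_span[OF _ p])
    fix t assume t: "P t \<and> P' t" "Poly_Mapping.keys t \<subseteq> A"
    let ?\<tau> = "part (\<lambda>i. i \<in> D) t" and ?s = "part (\<lambda>i. i \<notin> D) t"
    have "P ?\<tau>" using t(1) P(2) by (simp add: depends_on_def)
    then have "Poly_Mapping.single ?\<tau> (1 :: 'k) \<in> mono_ideal A P"
      using t(2) by (auto simp: mono_ideal_def keys_part intro!: polys_single)
    then obtain v where v: "\<forall>x\<in>X. v x \<in> polys A" "Poly_Mapping.single ?\<tau> (1 :: 'k) = (\<Sum>x\<in>X. v x * e x)"
      unfolding F.image by (elim exE conjE)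
    have "P' ?s" using t(1) depends_on_disjoint[OF P'(2) disjoint] by simp
    then have "Poly_Mapping.single ?s (1 :: 'k) \<in> mono_ideal A P'"
      using t(2) by (auto simp: mono_ideal_def keys_part intro!: polys_single)
    then obtain w where w: "\<forall>y\<in>Y. w y \<in> polys A" "Poly_Mapping.single ?s (1 :: 'k) = (\<Sum>y\<in>Y. w y * e' y)"
      unfolding G.image by (elim exE conjE)
    have "Poly_Mapping.single t (1 :: 'k) = Poly_Mapping.single ?\<tau> 1 * Poly_Mapping.single ?s 1"
      unfolding mult_single part_partition by simp
    also have "\<dots> = (\<Sum>x\<in>X. \<Sum>y\<in>Y. v x * e x * (w y * e' y))" unfolding v(2) w(2) by (rule sum_product)
    also have "\<dots> = (\<Sum>q\<in>X \<times> Y. v (fst q) * e (fst q) * (w (snd q) * e' (snd q)))"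
      by (simp add: sum.cartesian_product split_def)
    also have "\<dots> = (\<Sum>q\<in>X \<times> Y. (v (fst q) * w (snd q)) * \<epsilon> q)" by (simp only: ac_simps)
    finally show "\<exists>v. (\<forall>q\<in>X \<times> Y. v q \<in> polys A) \<and> Poly_Mapping.single t 1 = (\<Sum>q\<in>X \<times> Y. v q * \<epsilon> q)"
      using v(1) w(1) by (intro exI[of _ "\<lambda>q. v (fst q) * w (snd q)"]) (auto intro: polys_mult)
  qed
qed

lemma linear_resolution_tensor:
  "linear_resolution A (\<lambda>t. P t \<and> P' t) (r + r') (X \<times> Y) (\<lambda>p. h (fst p) + h' (snd p)) \<delta> \<epsilon>"
proof
  show "finite (X \<times> Y)" using F.finite_X G.finite_X by simp
  show "\<delta> p q \<in> homogeneous A 1" if "p \<in> X \<times> Y" "q \<in> X \<times> Y" for p q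
    unfolding tensor_d_def using that F.d_homogeneous G.d_homogeneous
    by (intro homogeneous_add) (auto intro: homogeneous_sign simp del: One_nat_def)
  show "h (fst p) + h' (snd p) = Suc (h (fst q) + h' (snd q))"
    if "p \<in> X \<times> Y" "q \<in> X \<times> Y" "\<delta> p q \<noteq> 0" for p q
  proof (rule ccontr)
    assume "\<not> ?thesis"
    then have "snd p = snd q \<longrightarrow> d (fst p) (fst q) = 0" "fst p = fst q \<longrightarrow> d' (snd p) (snd q) = 0"
      using that F.d_eq_0[of "fst p" "fst q"] G.d_eq_0[of "snd p" "snd q"] by auto
    then show False using that(3) by (simp add: tensor_d_def split: if_splits)
  qed
  show "\<epsilon> p \<in> homogeneous A (r + r')" if "p \<in> X \<times> Y" for p
    using that by (intro homogeneous_mult F.e_homogeneous G.e_homogeneous) auto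
  show "h (fst p) + h' (snd p) = 0" if "p \<in> X \<times> Y" "\<epsilon> p \<noteq> 0" for p
    using that F.e_eq_0[of "fst p"] G.e_eq_0[of "snd p"] by fastforce
  show "(\<Sum>s\<in>X \<times> Y. \<delta> p s * \<delta> s q) = 0" if "p \<in> X \<times> Y" "q \<in> X \<times> Y" for p q
    using that by (rule tensor_dd)
  show "(\<Sum>s\<in>X \<times> Y. \<delta> p s * \<epsilon> s) = 0" if "p \<in> X \<times> Y" for p
  proof -
    \<comment> \<open>A row of the differential is the boundary of a unit vector, which reduces the
      claim to the chain map on columns and \<open>G.de\<close>.\<close>
    define w where "w q = (if q = p then 1 else 0 :: ('v, 'k) mpoly)" for q
    have "\<delta> p s = (\<Sum>q\<in>X \<times> Y. w q * \<delta> q s)" for s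
      using that F.finite_X G.finite_X
      by (simp add: w_def if_distrib[of "\<lambda>c. c * _"] cong: if_cong)
    then have "(\<Sum>s\<in>X \<times> Y. \<delta> p s * \<epsilon> s) =
        (\<Sum>y\<in>Y. (\<Sum>x\<in>X. (\<Sum>q\<in>X \<times> Y. w q * \<delta> q (x, y)) * e x) * e' y)"
      unfolding augmentation by simp
    also have "\<dots> = (\<Sum>y\<in>Y. (\<Sum>b\<in>Y. (\<Sum>x\<in>X. w (x, b) * e x) * d' b y) * e' y)"
      by (simp add: column_augmentation_boundary)
    also have "\<dots> = 0" by (rule cycle_comp) (rule G.de)
    finally show ?thesis .
  qed
qed (use tensor_exact tensor_image in auto)

end

section \<open>Resolutions and matrices\<close>

definition unit_vec :: "nat \<Rightarrow> nat \<Rightarrow> 'a::zero_neq_one" where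
  "unit_vec p = (\<lambda>q. if q = p then 1 else 0)"

lemma unit_vec_carrier: "p < length as \<Longrightarrow> unit_vec p \<in> carrier (graded_free A as)"
  by (auto simp: graded_free_simps unit_vec_def)

text \<open>Scalar-valued maps suffice: each coordinate of a differential and the augmentation
  itself are instances.\<close>

lemma functional_expand:
  fixes g :: "(nat \<Rightarrow> ('v, 'k::field) mpoly) \<Rightarrow> ('v, 'k) mpoly"
  assumes add: "\<And>x y. x \<in> carrier (graded_free A as) \<Longrightarrow> y \<in> carrier (graded_free A as) \<Longrightarrow>
      g (\<lambda>i. x i + y i) = g x + g y"
    and smult: "\<And>a x. a \<in> polys A \<Longrightarrow> x \<in> carrier (graded_free A as) \<Longrightarrow> g (\<lambda>i. a * x i) = a * g x"
    and v: "v \<in> carrier (graded_free A as)"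
  shows "g v = (\<Sum>p<length as. v p * g (unit_vec p))"
proof -
  have "g (\<lambda>i. if i < m then v i else 0) = (\<Sum>p<m. v p * g (unit_vec p))" if "m \<le> length as" for m
    using that
  proof (induction m)
    case 0
    show ?case using smult[OF polys_0 v] by simp
  next
    case (Suc m)
    have "(\<lambda>i. if i < Suc m then v i else 0) = (\<lambda>i. (if i < m then v i else 0) + v m * unit_vec m i)"
      by (auto simp: unit_vec_def less_Suc_eq)
    moreover have "g (\<lambda>i. (if i < m then v i else 0) + v m * unit_vec m i) =
        g (\<lambda>i. if i < m then v i else 0) + g (\<lambda>i. v m * unit_vec m i)"
      using v Suc.prems by (intro add) (auto simp: graded_free_simps unit_vec_def)
    moreover have "g (\<lambda>i. v m * unit_vec m i) = v m * g (unit_vec m)"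
      using v Suc.prems by (intro smult unit_vec_carrier) (auto simp: graded_free_simps)
    ultimately show ?case using Suc by simp
  qed
  from this[of "length as"] have "g (\<lambda>i. if i < length as then v i else 0) = (\<Sum>p<length as. v p * g (unit_vec p))"
    by simp
  moreover have "(\<lambda>i. if i < length as then v i else 0) = v"
    using v by (auto simp: graded_free_simps)
  ultimately show ?thesis by simp
qed

lemma graded_hom_free_expand:
  assumes "f \<in> graded_hom (poly_ring A) (graded_free A as) (graded_free A as')"
    and "v \<in> carrier (graded_free A as)"
  shows "f v q = (\<Sum>p<length as. v p * f (unit_vec p) q)"
  using assms(1)
  by (intro functional_expand[where g = "\<lambda>v. f v q", OF _ _ assms(2)])
    (auto simp: graded_hom_def graded_free_simps(2-4))

lemma graded_hom_ideal_expand: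
  assumes "f \<in> graded_hom (poly_ring A) (graded_free A as) (graded_ideal A I)"
    and "v \<in> carrier (graded_free A as)"
  shows "f v = (\<Sum>p<length as. v p * f (unit_vec p))"
  using assms(1)
  by (intro functional_expand[where g = f, OF _ _ assms(2)])
    (auto simp: graded_hom_def graded_free_simps(2-4) graded_ideal_def)

lemma graded_free_component:
  "v \<in> component (graded_free A as) k \<longleftrightarrow>
    (\<forall>i<length as. v i \<in> (if as ! i \<le> k then homogeneous A (k - as ! i) else {0})) \<and> (\<forall>i\<ge>length as. v i = 0)"
  by (simp add: graded_free_def)

text \<open>A generator of degree \<open>r + i + 1\<close> is sent to a combination of generators of
  degree \<open>r + i\<close>, so a linear shape forces every matrix entry to be a linear form or
  0.\<close>

lemma linear_resolution_of_minimal_free_resolution: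
  fixes \<phi> :: "nat \<Rightarrow> (nat \<Rightarrow> ('v, 'k::field) mpoly) \<Rightarrow> (nat \<Rightarrow> ('v, 'k) mpoly)"
  assumes res: "minimal_free_resolution A (linear_shape r l b) \<phi> (graded_ideal A (mono_ideal A P))"
  shows "\<exists>(d :: nat \<times> nat \<Rightarrow> nat \<times> nat \<Rightarrow> ('v, 'k) mpoly) e.
    linear_resolution A P r (SIGMA i:{..l}. {..<b i}) fst d e"
proof -
  \<comment> \<open>Ranks are extended by 0 beyond \<open>l\<close>, so that all homological degrees
    are treated alike.\<close>
  define n where "n i = (if i \<le> l then b i else 0)" for i
  let ?as = "linear_shape r l b"
  let ?F = "\<lambda>i. graded_free A (?as i) :: (('v, 'k) mpoly, nat \<Rightarrow> ('v, 'k) mpoly) graded_module"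
  define X where "X = (SIGMA i:{..l}. {..<b i})"
  have inX: "(i, p) \<in> X \<longleftrightarrow> p < n i" for i p by (auto simp: n_def X_def)
  have len: "length (?as i) = n i" for i by (simp add: linear_shape_def n_def)
  have nth: "?as i ! p = r + i" if "p < n i" for i p
    using that by (auto simp: linear_shape_def n_def split: if_splits)
  have carrier: "v \<in> carrier (?F i) \<longleftrightarrow> (\<forall>p<n i. v p \<in> polys A) \<and> (\<forall>p\<ge>n i. v p = 0)" for v i
    by (simp add: graded_free_simps len)
  have hom: "\<And>i. \<phi> (Suc i) \<in> graded_hom (poly_ring A) (?F (Suc i)) (?F i)"
    and ker: "\<And>i. i \<ge> 1 \<Longrightarrow> {x \<in> carrier (?F i). \<phi> i x = (\<lambda>_. 0)} = \<phi> (Suc i) ` carrier (?F (Suc i))"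
    using res unfolding minimal_free_resolution_def Let_def graded_free_simps(2) by simp_all
  have "\<exists>\<epsilon>\<in>graded_hom (poly_ring A) (?F 0) (graded_ideal A (mono_ideal A P)).
      \<epsilon> ` carrier (?F 0) = mono_ideal A P \<and> {x \<in> carrier (?F 0). \<epsilon> x = 0} = \<phi> 1 ` carrier (?F 1)"
    using res unfolding minimal_free_resolution_def Let_def by (simp add: graded_ideal_def)
  then obtain \<epsilon> where \<epsilon>: "\<epsilon> \<in> graded_hom (poly_ring A) (?F 0) (graded_ideal A (mono_ideal A P))"
    "\<epsilon> ` carrier (?F 0) = mono_ideal A P" "{x \<in> carrier (?F 0). \<epsilon> x = 0} = \<phi> 1 ` carrier (?F 1)"
    by (elim bexE conjE)
  have expand: "\<phi> (Suc i) v q = (\<Sum>p<n (Suc i). v p * \<phi> (Suc i) (unit_vec p) q)"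
    if "v \<in> carrier (?F (Suc i))" for i v q
    using graded_hom_free_expand[OF hom that] by (simp add: len)
  have \<epsilon>_expand: "\<epsilon> v = (\<Sum>p<n 0. v p * \<epsilon> (unit_vec p))" if "v \<in> carrier (?F 0)" for v
    using graded_hom_ideal_expand[OF \<epsilon>(1) that] by (simp add: len)
  have closed: "\<phi> (Suc i) v \<in> carrier (?F i)" if "v \<in> carrier (?F (Suc i))" for i v
    using hom[of i] that by (auto simp: graded_hom_def)
  have unit: "unit_vec p \<in> carrier (?F i)" "unit_vec p \<in> component (?F i) (r + i)" if "p < n i" for p i
    using that by (auto simp: carrier graded_free_component len nth unit_vec_def homogeneous_1)
  define d where "d x y = (if fst x = Suc (fst y) then \<phi> (fst x) (unit_vec (snd x)) (snd y) else 0)"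
    for x y :: "nat \<times> nat"
  define e where "e x = (if fst x = 0 then \<epsilon> (unit_vec (snd x)) else 0)" for x :: "nat \<times> nat"
  \<comment> \<open>The slice of a vector in homological degree \<open>i\<close>, padded with zeros
    as the carrier demands.\<close>
  define sec where "sec v i = (\<lambda>p. if p < n i then v (i, p) else (0 :: ('v, 'k) mpoly))" for v i
  have sec: "sec v i \<in> carrier (?F i)" if "\<forall>x\<in>X. v x \<in> polys A" for v i
    using that inX by (simp add: carrier sec_def)
  have sum_X: "(\<Sum>x\<in>X. if fst x = j then f x else 0) = (\<Sum>p<n j. f (j, p))"
    for f :: "nat \<times> nat \<Rightarrow> ('v, 'k) mpoly" and j
  proof -
    have "(\<Sum>x\<in>X. if fst x = j then f x else 0) = (\<Sum>i\<le>l. \<Sum>p<b i. if i = j then f (i, p) else 0)"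
      unfolding X_def by (subst sum.Sigma) (auto intro!: sum.cong)
    also have "\<dots> = (\<Sum>i\<le>l. if i = j then \<Sum>p<b i. f (i, p) else 0)"
      by (intro sum.cong) auto
    finally show ?thesis by (simp add: n_def)
  qed
  have boundary: "(\<Sum>x\<in>X. v x * d x (j, q)) = \<phi> (Suc j) (sec v (Suc j)) q"
    if "\<forall>x\<in>X. v x \<in> polys A" for v j q
  proof -
    have "(\<Sum>x\<in>X. v x * d x (j, q)) =
        (\<Sum>x\<in>X. if fst x = Suc j then v x * \<phi> (Suc j) (unit_vec (snd x)) q else 0)"
      by (intro sum.cong) (auto simp: d_def)
    also have "\<dots> = (\<Sum>p<n (Suc j). sec v (Suc j) p * \<phi> (Suc j) (unit_vec p) q)"
      unfolding sum_X by (simp add: sec_def)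
    finally show ?thesis using expand[OF sec[OF that]] by simp
  qed
  have augmentation: "(\<Sum>x\<in>X. v x * e x) = \<epsilon> (sec v 0)" if "\<forall>x\<in>X. v x \<in> polys A" for v
  proof -
    have "(\<Sum>x\<in>X. v x * e x) = (\<Sum>x\<in>X. if fst x = 0 then v x * \<epsilon> (unit_vec (snd x)) else 0)"
      by (intro sum.cong) (auto simp: e_def)
    also have "\<dots> = (\<Sum>p<n 0. sec v 0 p * \<epsilon> (unit_vec p))"
      unfolding sum_X by (simp add: sec_def)
    finally show ?thesis using \<epsilon>_expand[OF sec[OF that]] by simp
  qed
  have d_hom: "d x y \<in> homogeneous A 1" if "x \<in> X" "y \<in> X" for x y
  proof (cases "fst x = Suc (fst y)")
    case True
    obtain j q p where xy: "y = (j, q)" "x = (Suc j, p)" using True by (cases x; cases y) auto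
    have p: "p < n (Suc j)" and q: "q < n j" using that inX unfolding xy by blast+
    have "\<phi> (Suc j) (unit_vec p) \<in> component (?F j) (r + Suc j)"
      using hom[of j] unit(2)[OF p] unfolding graded_hom_def by blast
    then show ?thesis using q by (simp add: xy d_def graded_free_component len nth)
  qed (simp add: d_def)
  have e_hom: "e x \<in> homogeneous A r" if "x \<in> X" for x
  proof (cases "fst x = 0")
    case True
    then obtain p where x: "x = (0, p)" by (cases x) auto
    have p: "p < n 0" using that inX unfolding x by blast
    have "\<epsilon> (unit_vec p) \<in> component (graded_ideal A (mono_ideal A P)) (r + 0)"
      using \<epsilon>(1) unit(2)[OF p] unfolding graded_hom_def by blast
    then show ?thesis by (simp add: x e_def graded_ideal_def)
  qed (simp add: e_def)
  have d_polys: "\<forall>y\<in>X. d x y \<in> polys A" if "x \<in> X" for x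
    using d_hom[OF that] homogeneous_polys by blast
  have sec_d: "sec (d (i, p)) j = (if i = Suc j then \<phi> (Suc j) (unit_vec p) else (\<lambda>_. 0))"
    if p: "p < n i" for i p j
  proof (cases "i = Suc j")
    case True
    then have "\<phi> (Suc j) (unit_vec p) \<in> carrier (?F j)"
      using closed unit(1) p by blast
    then show ?thesis using True by (auto simp: sec_def d_def carrier)
  qed (auto simp: sec_def d_def)
  have zero: "\<phi> (Suc j) (\<lambda>_. 0) q = 0" for j q
    using expand[of "\<lambda>_. 0" j q] by (simp add: carrier)
  have "linear_resolution A P r X fst d e"
  proof
    show "finite X" by (simp add: X_def)
    show "d x y \<in> homogeneous A 1" if "x \<in> X" "y \<in> X" for x y
      using that by (rule d_hom)
    show "e x \<in> homogeneous A r" if "x \<in> X" for x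
      using that by (rule e_hom)
    show "fst x = Suc (fst y)" if "d x y \<noteq> 0" for x y
      using that by (simp add: d_def split: if_splits)
    show "fst x = 0" if "e x \<noteq> 0" for x
      using that by (simp add: e_def split: if_splits)
    show "(\<Sum>y\<in>X. d x y * d y z) = 0" if xz: "x \<in> X" "z \<in> X" for x z
    proof -
      obtain i p k q where x: "x = (i, p)" "z = (k, q)" by (cases x; cases z)
      have p: "p < n i" using xz(1) inX unfolding x by blast
      have "\<phi> (Suc k) (\<phi> (Suc (Suc k)) (unit_vec p)) = (\<lambda>_. 0)" if "i = Suc (Suc k)"
        using ker[of "Suc k"] unit(1)[OF p] that by auto
      then show ?thesis
        using boundary[OF d_polys[OF xz(1)], of k q] by (simp add: x sec_d[OF p] zero)
    qed
    show "(\<Sum>y\<in>X. d x y * e y) = 0" if x: "x \<in> X" for x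
    proof -
      obtain i p where ip: "x = (i, p)" by (cases x)
      have p: "p < n i" using x inX unfolding ip by blast
      have "\<epsilon> (\<phi> 1 (unit_vec p)) = 0" if "i = Suc 0"
        using \<epsilon>(3) unit(1)[OF p] that by auto
      moreover have "\<epsilon> (\<lambda>_. 0) = 0"
        using \<epsilon>_expand[of "\<lambda>_. 0"] by (simp add: carrier)
      ultimately show ?thesis
        using augmentation[OF d_polys[OF x]] by (simp add: ip sec_d[OF p])
    qed
    show "\<exists>w. (\<forall>x\<in>X. w x \<in> polys A) \<and> (\<forall>y\<in>X. v y = (\<Sum>x\<in>X. w x * d x y))"
      if v: "\<And>x. x \<in> X \<Longrightarrow> v x \<in> polys A" "\<And>y. y \<in> X \<Longrightarrow> (\<Sum>x\<in>X. v x * d x y) = 0"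
        "(\<Sum>x\<in>X. v x * e x) = 0" for v
    proof -
      have v1: "\<forall>x\<in>X. v x \<in> polys A" using v(1) by simp
      \<comment> \<open>A cycle of the total complex is a cycle in every degree; in degree 0 the
        augmentation takes the place of the differential.\<close>
      have "\<exists>w\<in>carrier (?F (Suc i)). sec v i = \<phi> (Suc i) w" for i
      proof (cases i)
        case 0
        then show ?thesis using v(3) augmentation[OF v1] \<epsilon>(3) sec[OF v1, of 0] by auto
      next
        case (Suc j)
        have "\<phi> (Suc j) (sec v (Suc j)) q = 0" for q
        proof (cases "q < n j")
          case True
          then have "(j, q) \<in> X" using inX by blast
          then show ?thesis using v(2) boundary[OF v1] by metis
        next
          case False
          then show ?thesis using closed[OF sec[OF v1, of "Suc j"]] by (simp add: carrier)
        qed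
        then have "sec v (Suc j) \<in> {x \<in> carrier (?F (Suc j)). \<phi> (Suc j) x = (\<lambda>_. 0)}"
          using sec[OF v1] by auto
        then show ?thesis unfolding Suc by (subst (asm) ker) auto
      qed
      then have "\<forall>i. \<exists>w. w \<in> carrier (?F (Suc i)) \<and> sec v i = \<phi> (Suc i) w" by blast
      from choice[OF this] obtain W where W: "\<forall>i. W i \<in> carrier (?F (Suc i)) \<and> sec v i = \<phi> (Suc i) (W i)"
        by (elim exE)
      \<comment> \<open>The lift of the slice in degree \<open>i\<close> sits in degree
        \<open>Suc i\<close>; hence the shift, and nothing in degree 0.\<close>
      define w where "w x = (if fst x = 0 then 0 else W (fst x - 1) (snd x))" for x :: "nat \<times> nat"
      have w: "\<forall>x\<in>X. w x \<in> polys A"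
      proof
        fix x assume x: "x \<in> X"
        show "w x \<in> polys A"
        proof (cases "fst x")
          case (Suc i)
          then obtain p where p: "x = (Suc i, p)" by (cases x) auto
          have "p < n (Suc i)" using x inX unfolding p by blast
          then show ?thesis using W by (simp add: p w_def carrier)
        qed (simp add: w_def)
      qed
      have "v y = (\<Sum>x\<in>X. w x * d x y)" if y: "y \<in> X" for y
      proof -
        obtain j q where jq: "y = (j, q)" by (cases y)
        have q: "q < n j" using y inX unfolding jq by blast
        have "sec w (Suc j) = W j"
        proof
          fix p
          have "W j p = 0" if "p \<ge> n (Suc j)" using W that carrier by blast
          then show "sec w (Suc j) p = W j p" by (simp add: sec_def w_def)
        qed
        then have "(\<Sum>x\<in>X. w x * d x y) = sec v j q"
          using boundary[OF w, of j q] W by (simp add: jq)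
        then show ?thesis using q by (simp add: jq sec_def)
      qed
      then show ?thesis using w by (intro exI[of _ w]) simp
    qed
    show "p \<in> mono_ideal A P \<longleftrightarrow> (\<exists>v. (\<forall>x\<in>X. v x \<in> polys A) \<and> p = (\<Sum>x\<in>X. v x * e x))" for p
    proof
      assume "p \<in> mono_ideal A P"
      then obtain u where u: "u \<in> carrier (?F 0)" "p = \<epsilon> u" using \<epsilon>(2) by auto
      let ?v = "\<lambda>x. if fst x = 0 then u (snd x) else 0"
      have v: "\<forall>x\<in>X. ?v x \<in> polys A" using u(1) using inX by (auto simp: carrier)
      have "sec ?v 0 = u" using u(1) by (auto simp: sec_def carrier)
      then show "\<exists>v. (\<forall>x\<in>X. v x \<in> polys A) \<and> p = (\<Sum>x\<in>X. v x * e x)"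
        using v augmentation[OF v] u(2) by (intro exI[of _ ?v]) simp
    next
      assume "\<exists>v. (\<forall>x\<in>X. v x \<in> polys A) \<and> p = (\<Sum>x\<in>X. v x * e x)"
      then obtain v where "\<forall>x\<in>X. v x \<in> polys A" "p = (\<Sum>x\<in>X. v x * e x)" by (elim exE conjE)
      then show "p \<in> mono_ideal A P" using augmentation sec \<epsilon>(2) by auto
    qed
  qed
  then show ?thesis unfolding X_def by (intro exI)
qed

text \<open>Numbering the basis elements of each homological degree turns one matrix back into a
  sequence of maps; minimality comes from the linear entries.\<close>

lemma minimal_free_resolution_of_linear_resolution:
  fixes d :: "'x \<Rightarrow> 'x \<Rightarrow> ('v, 'k::field) mpoly"
  assumes "linear_resolution A P r X h d e"
    and hl: "\<And>x. x \<in> X \<Longrightarrow> h x \<le> l"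
    and card: "\<And>i. i \<le> l \<Longrightarrow> card {x \<in> X. h x = i} = b i"
  shows "\<exists>\<phi> :: nat \<Rightarrow> (nat \<Rightarrow> ('v, 'k) mpoly) \<Rightarrow> (nat \<Rightarrow> ('v, 'k) mpoly).
    minimal_free_resolution A (linear_shape r l b) \<phi> (graded_ideal A (mono_ideal A P))"
proof -
  interpret linear_resolution A P r X h d e by fact
  define n where "n i = (if i \<le> l then b i else 0)" for i
  let ?as = "linear_shape r l b"
  let ?F = "\<lambda>i. graded_free A (?as i) :: (('v, 'k) mpoly, nat \<Rightarrow> ('v, 'k) mpoly) graded_module"
  have len: "length (?as i) = n i" for i by (simp add: linear_shape_def n_def)
  have nth: "?as i ! p = r + i" if "p < n i" for i p
    using that by (auto simp: linear_shape_def n_def split: if_splits)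
  have carrier: "v \<in> carrier (?F i) \<longleftrightarrow> (\<forall>p<n i. v p \<in> polys A) \<and> (\<forall>p\<ge>n i. v p = 0)" for v i
    by (simp add: graded_free_simps len)
  have "\<exists>g. bij_betw g {..<n i} {x \<in> X. h x = i}" for i
  proof -
    have "card {x \<in> X. h x = i} = n i"
    proof (cases "i \<le> l")
      case False
      then have "{x \<in> X. h x = i} = {}" using hl by force
      then show ?thesis using False by (simp only: n_def if_False card.empty)
    qed (simp add: n_def card)
    then show ?thesis
      using ex_bij_betw_nat_finite[of "{x \<in> X. h x = i}"] finite_X by (simp add: lessThan_atLeast0)
  qed
  then obtain g where g: "\<And>i. bij_betw (g i) {..<n i} {x \<in> X. h x = i}" by metis
  have gX: "g i p \<in> X" "h (g i p) = i" if "p < n i" for i p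
    using bij_betwE[OF g[of i]] that by auto
  define idx where "idx x = inv_into {..<n (h x)} (g (h x)) x" for x
  have idx: "idx x < n (h x)" "g (h x) (idx x) = x" if "x \<in> X" for x
  proof -
    have img: "x \<in> g (h x) ` {..<n (h x)}" using g[of "h x"] that by (auto simp: bij_betw_def)
    then show "idx x < n (h x)" "g (h x) (idx x) = x"
      using inv_into_into[OF img] f_inv_into_f[OF img] by (simp_all add: idx_def)
  qed
  have idx_g: "idx (g i p) = p" if "p < n i" for i p
    using g[of i] that gX[OF that] unfolding idx_def bij_betw_def by (simp add: inv_into_f_f)
  have sum_g: "(\<Sum>p<n i. f (g i p)) = (\<Sum>x\<in>X. if h x = i then f x else 0)" for f :: "'x \<Rightarrow> ('v, 'k) mpoly" and i
    using sum.reindex_bij_betw[OF g[of i], of f] finite_X by (simp add: sum.inter_filter)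
  define \<phi> where "\<phi> i v = (\<lambda>q. if q < n (i - 1) then \<Sum>p<n i. v p * d (g i p) (g (i - 1) q) else 0)"
    for i and v :: "nat \<Rightarrow> ('v, 'k) mpoly"
  define \<epsilon> where "\<epsilon> v = (\<Sum>p<n 0. v p * e (g 0 p))" for v :: "nat \<Rightarrow> ('v, 'k) mpoly"
  \<comment> \<open>\<open>ext\<close> places a vector in degree \<open>i\<close> of the total
    module, and \<open>sec\<close> reads off one degree.\<close>
  define ext where "ext i v = (\<lambda>x. if h x = i then v (idx x) else 0)" for i and v :: "nat \<Rightarrow> ('v, 'k) mpoly"
  define sec where "sec w i = (\<lambda>p. if p < n i then w (g i p) else 0)" for w :: "'x \<Rightarrow> ('v, 'k) mpoly" and i
  have ext_polys: "ext i v x \<in> polys A" if "v \<in> carrier (?F i)" "x \<in> X" for i v x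
    using that idx by (auto simp: ext_def carrier)
  have sec_carrier: "sec w i \<in> carrier (?F i)" if "\<And>x. x \<in> X \<Longrightarrow> w x \<in> polys A" for w i
    using that gX by (simp add: carrier sec_def)
  have \<phi>_sec: "\<phi> (Suc i) (sec w (Suc i)) q = (\<Sum>x\<in>X. w x * d x (g i q))" if q: "q < n i" for w i q
  proof -
    have "\<phi> (Suc i) (sec w (Suc i)) q = (\<Sum>p<n (Suc i). w (g (Suc i) p) * d (g (Suc i) p) (g i q))"
      using q by (simp add: \<phi>_def sec_def)
    also have "\<dots> = (\<Sum>x\<in>X. if h x = Suc i then w x * d x (g i q) else 0)" by (rule sum_g)
    also have "\<dots> = (\<Sum>x\<in>X. w x * d x (g i q))"
      using gX[OF q] d_eq_0 by (intro sum.cong) auto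
    finally show ?thesis .
  qed
  have \<epsilon>_sec: "\<epsilon> (sec w 0) = (\<Sum>x\<in>X. w x * e x)" for w
  proof -
    have "\<epsilon> (sec w 0) = (\<Sum>p<n 0. w (g 0 p) * e (g 0 p))" by (simp add: \<epsilon>_def sec_def)
    also have "\<dots> = (\<Sum>x\<in>X. if h x = 0 then w x * e x else 0)" by (rule sum_g)
    also have "\<dots> = (\<Sum>x\<in>X. w x * e x)" using e_eq_0 by (intro sum.cong) auto
    finally show ?thesis .
  qed
  have sec_ext: "sec (ext i v) i = v" if "v \<in> carrier (?F i)" for i v
    using that gX idx_g by (auto simp: sec_def ext_def carrier)
  have sec_ext_other: "sec (ext i v) j = (\<lambda>_. 0)" if "j \<noteq> i" for i j v
    using that gX by (auto simp: sec_def ext_def)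
  have \<phi>_0: "\<phi> i (\<lambda>_. 0) = (\<lambda>_. 0)" for i by (auto simp: \<phi>_def)
  have \<phi>_outside: "\<phi> (Suc i) v q = 0" if "q \<ge> n i" for i v q using that by (simp add: \<phi>_def)
  have closed: "\<phi> (Suc i) v \<in> carrier (?F i)" if "v \<in> carrier (?F (Suc i))" for i v
    using that gX by (auto simp: carrier \<phi>_def intro!: polys_sum polys_mult d_polys)
  have \<phi>_add: "\<phi> (Suc i) (\<lambda>j. v j + w j) = (\<lambda>j. \<phi> (Suc i) v j + \<phi> (Suc i) w j)" for i v w
    by (auto simp: \<phi>_def distrib_right sum.distrib)
  have \<phi>_smult: "\<phi> (Suc i) (\<lambda>j. a * v j) = (\<lambda>j. a * \<phi> (Suc i) v j)" for i a v
    by (auto simp: \<phi>_def sum_distrib_left mult.assoc)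
  have "\<phi> (Suc i) v \<in> component (?F i) k" if v: "v \<in> component (?F (Suc i)) k" for i v k
  proof -
    have "\<phi> (Suc i) v q \<in> (if r + i \<le> k then homogeneous A (k - (r + i)) else {0})" if q: "q < n i" for q
    proof (cases "r + Suc i \<le> k")
      case True
      have "v p * d (g (Suc i) p) (g i q) \<in> homogeneous A (k - (r + i))" if p: "p < n (Suc i)" for p
      proof -
        have "v p \<in> homogeneous A (k - (r + Suc i))"
          using v p True by (auto simp: graded_free_component len nth)
        then have "v p * d (g (Suc i) p) (g i q) \<in> homogeneous A (k - (r + Suc i) + 1)"
          using gX p q by (intro homogeneous_mult d_homogeneous) auto
        moreover have "k - (r + Suc i) + 1 = k - (r + i)" using True by simp
        ultimately show ?thesis by simp
      qed
      then have "\<phi> (Suc i) v q \<in> homogeneous A (k - (r + i))"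
        using q unfolding \<phi>_def by (auto intro!: homogeneous_sum)
      then show ?thesis using True by simp
    next
      \<comment> \<open>Below degree \<open>r + Suc i\<close> the source contains only 0, even at
        \<open>k = r + i\<close>, where the target already begins.\<close>
      case False
      then have "v p = 0" if "p < n (Suc i)" for p
        using v that by (auto simp: graded_free_component len nth)
      then show ?thesis using q by (simp add: \<phi>_def)
    qed
    then show ?thesis
      by (cases "r + i \<le> k") (simp_all add: graded_free_component len nth \<phi>_outside)
  qed
  then have hom: "\<phi> (Suc i) \<in> graded_hom (poly_ring A) (?F (Suc i)) (?F i)" for i
    using closed by (auto simp: graded_hom_def graded_free_simps(2-4) \<phi>_add \<phi>_smult)
  have "\<epsilon> v \<in> homogeneous A k" if v: "v \<in> component (?F 0) k" for v k
    unfolding \<epsilon>_def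
  proof (rule homogeneous_sum)
    fix p assume "p \<in> {..<n 0}"
    then have p: "p < n 0" by simp
    show "v p * e (g 0 p) \<in> homogeneous A k"
    proof (cases "r \<le> k")
      case True
      have "v p \<in> homogeneous A (k - r)"
        using v p True by (auto simp: graded_free_component len nth)
      then have "v p * e (g 0 p) \<in> homogeneous A (k - r + r)"
        using gX p by (intro homogeneous_mult e_homogeneous) auto
      then show ?thesis using True by simp
    next
      case False
      then have "v p = 0" using v p by (auto simp: graded_free_component len nth)
      then show ?thesis by simp
    qed
  qed
  moreover have \<epsilon>_closed: "\<epsilon> v \<in> mono_ideal A P" if v: "v \<in> carrier (?F 0)" for v
    using \<epsilon>_sec[of "ext 0 v"] ext_polys[OF v] unfolding image sec_ext[OF v] by blast
  moreover have "v \<in> carrier (?F 0)" if "v \<in> component (?F 0) k" for v k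
    using that by (cases "r \<le> k") (auto simp: graded_free_component carrier len nth intro: homogeneous_polys)
  ultimately have \<epsilon>_hom: "\<epsilon> \<in> graded_hom (poly_ring A) (?F 0) (graded_ideal A (mono_ideal A P))"
    by (auto simp: graded_hom_def graded_free_simps(2-4) graded_ideal_def \<epsilon>_def
        distrib_right sum.distrib sum_distrib_left mult.assoc)
  have \<phi>\<phi>: "\<phi> (Suc i) (\<phi> (Suc (Suc i)) v) = (\<lambda>_. 0)" if v: "v \<in> carrier (?F (Suc (Suc i)))" for i v
  proof
    fix q
    show "\<phi> (Suc i) (\<phi> (Suc (Suc i)) v) q = 0"
    proof (cases "q < n i")
      case True
      let ?w = "\<lambda>y. \<Sum>x\<in>X. ext (Suc (Suc i)) v x * d x y"
      have "\<phi> (Suc (Suc i)) v = sec ?w (Suc i)"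
        using \<phi>_sec[of _ "Suc i" "ext (Suc (Suc i)) v"] unfolding sec_ext[OF v]
        by (auto simp: sec_def \<phi>_outside)
      then have "\<phi> (Suc i) (\<phi> (Suc (Suc i)) v) q = (\<Sum>y\<in>X. ?w y * d y (g i q))"
        using \<phi>_sec[OF True] by simp
      also have "\<dots> = 0" using dd gX[OF True] by (intro cycle_comp) auto
      finally show ?thesis .
    qed (simp add: \<phi>_outside)
  qed
  have \<epsilon>\<phi>: "\<epsilon> (\<phi> (Suc 0) v) = 0" if v: "v \<in> carrier (?F (Suc 0))" for v
  proof -
    let ?w = "\<lambda>y. \<Sum>x\<in>X. ext (Suc 0) v x * d x y"
    have "\<phi> (Suc 0) v = sec ?w 0"
      using \<phi>_sec[of _ 0 "ext (Suc 0) v"] unfolding sec_ext[OF v]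
      by (auto simp: sec_def \<phi>_outside)
    then have "\<epsilon> (\<phi> (Suc 0) v) = (\<Sum>y\<in>X. ?w y * e y)" using \<epsilon>_sec by simp
    also have "\<dots> = 0" using de by (intro cycle_comp) auto
    finally show ?thesis .
  qed
  have lift: "\<exists>w\<in>carrier (?F (Suc i)). v = \<phi> (Suc i) w"
    if v: "v \<in> carrier (?F i)" and cyc: "i > 0 \<Longrightarrow> \<phi> i v = (\<lambda>_. 0)" "i = 0 \<Longrightarrow> \<epsilon> v = 0" for i v
  proof -
    \<comment> \<open>The vector \<open>ext i v\<close> is a total cycle: in its own degree by
      hypothesis, in the others because it vanishes there.\<close>
    have "\<exists>w. (\<forall>x\<in>X. w x \<in> polys A) \<and> (\<forall>y\<in>X. ext i v y = (\<Sum>x\<in>X. w x * d x y))"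
    proof (rule exact)
      show "ext i v x \<in> polys A" if "x \<in> X" for x by (rule ext_polys[OF v that])
      show "(\<Sum>x\<in>X. ext i v x * d x y) = 0" if y: "y \<in> X" for y
      proof -
        have "\<phi> (Suc (h y)) (sec (ext i v) (Suc (h y))) = (\<lambda>_. 0)"
          using cyc(1) sec_ext[OF v] by (cases "i = Suc (h y)") (simp_all add: sec_ext_other \<phi>_0)
        then show ?thesis using \<phi>_sec[OF idx(1)[OF y], of "ext i v"] idx(2)[OF y] by simp
      qed
      have "\<epsilon> (sec (ext i v) 0) = 0"
        using cyc(2) sec_ext[OF v] by (cases "i = 0") (simp_all add: sec_ext_other \<epsilon>_def)
      then show "(\<Sum>x\<in>X. ext i v x * e x) = 0" by (simp add: \<epsilon>_sec)
    qed
    then obtain w where w: "\<forall>x\<in>X. w x \<in> polys A" "\<forall>y\<in>X. ext i v y = (\<Sum>x\<in>X. w x * d x y)"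
      by (elim exE conjE)
    have "v = \<phi> (Suc i) (sec w (Suc i))"
    proof
      fix q
      show "v q = \<phi> (Suc i) (sec w (Suc i)) q"
      proof (cases "q < n i")
        case True
        have "v q = ext i v (g i q)" using gX[OF True] idx_g[OF True] by (simp add: ext_def)
        then show ?thesis using w(2) gX[OF True] \<phi>_sec[OF True] by simp
      next
        case False
        then show ?thesis using v by (simp add: carrier \<phi>_outside)
      qed
    qed
    moreover have "sec w (Suc i) \<in> carrier (?F (Suc i))" using w(1) by (intro sec_carrier) simp
    ultimately show ?thesis by blast
  qed
  have minimal: "\<phi> (Suc i) v \<in> ideal_smult (poly_ring A) (irrelevant_ideal A) (?F i)"
    if v: "v \<in> carrier (?F (Suc i))" for i v
    unfolding ideal_smult_def
  proof (rule InterI)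
    fix H
    assume "H \<in> {H. submodule H (poly_ring A) (?F i) \<and>
      {a \<odot>\<^bsub>?F i\<^esub> x | a x. a \<in> irrelevant_ideal A \<and> x \<in> carrier (?F i)} \<subseteq> H}"
    then have H: "submodule H (poly_ring A) (?F i)"
      and gen: "\<And>a x. a \<in> irrelevant_ideal A \<Longrightarrow> x \<in> carrier (?F i) \<Longrightarrow> a \<odot>\<^bsub>?F i\<^esub> x \<in> H"
      by blast+
    have zero: "(\<lambda>_. 0) \<in> H"
      using subgroup.one_closed[OF submodule.axioms(1)[OF H]] by (simp add: graded_free_simps)
    have add: "(\<lambda>j. x j + y j) \<in> H" if "x \<in> H" "y \<in> H" for x y
      using subgroup.m_closed[OF submodule.axioms(1)[OF H] that] by (simp add: graded_free_simps)
    have sum: "(\<lambda>j. \<Sum>s\<in>T. f s j) \<in> H" if "finite T" "\<And>s. s \<in> T \<Longrightarrow> f s \<in> H" for T and f :: "nat \<times> nat \<Rightarrow> _"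
      using that
    proof (induction T rule: finite_induct)
      case (insert s T)
      then show ?case using add[of "f s" "\<lambda>j. \<Sum>s\<in>T. f s j"] by simp
    qed (simp add: zero)
    \<comment> \<open>Expanding over all matrix entries writes the value as a sum of linear forms
      times vectors supported in one position.\<close>
    let ?T = "{..<n i} \<times> {..<n (Suc i)}"
    let ?f = "\<lambda>(q, p) j. d (g (Suc i) p) (g i q) * (v p * unit_vec q j)"
    have "?f s \<in> H" if sT: "s \<in> ?T" for s
    proof -
      obtain q p where s: "s = (q, p)" "q < n i" "p < n (Suc i)" using sT by auto
      have "d (g (Suc i) p) (g i q) \<in> irrelevant_ideal A"
        using s gX by (intro homogeneous_1_in_irrelevant_ideal d_homogeneous) auto
      moreover have "(\<lambda>j. v p * unit_vec q j) \<in> carrier (?F i)"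
        using v s by (auto simp: carrier unit_vec_def)
      ultimately show ?thesis using gen s by (simp add: graded_free_simps)
    qed
    then have "(\<lambda>j. \<Sum>s\<in>?T. ?f s j) \<in> H" by (intro sum) auto
    moreover have "(\<Sum>s\<in>?T. ?f s j) = \<phi> (Suc i) v j" for j
    proof -
      have "(\<Sum>s\<in>?T. ?f s j) = (\<Sum>q<n i. \<Sum>p<n (Suc i). ?f (q, p) j)"
        by (simp add: sum.cartesian_product split_def)
      also have "\<dots> = (\<Sum>q<n i. if q = j then \<Sum>p<n (Suc i). v p * d (g (Suc i) p) (g i q) else 0)"
        by (intro sum.cong) (auto simp: unit_vec_def ac_simps)
      finally show ?thesis by (simp add: \<phi>_def)
    qed
    ultimately show "\<phi> (Suc i) v \<in> H" by simp
  qed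
  have "minimal_free_resolution A ?as \<phi> (graded_ideal A (mono_ideal A P))"
    unfolding minimal_free_resolution_def Let_def graded_free_simps(2)
  proof (intro conjI allI impI)
    show "\<phi> (Suc i) \<in> graded_hom (poly_ring A) (?F (Suc i)) (?F i)" for i by (rule hom)
    show "\<phi> (Suc i) ` carrier (?F (Suc i)) \<subseteq> ideal_smult (poly_ring A) (irrelevant_ideal A) (?F i)" for i
      using minimal by blast
    show "{x \<in> carrier (?F i). \<phi> i x = (\<lambda>i. 0)} = \<phi> (Suc i) ` carrier (?F (Suc i))" if i: "1 \<le> i" for i
    proof -
      obtain j where j: "i = Suc j" using i by (cases i) auto
      show ?thesis
      proof
        show "{x \<in> carrier (?F i). \<phi> i x = (\<lambda>i. 0)} \<subseteq> \<phi> (Suc i) ` carrier (?F (Suc i))"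
        proof
          fix x assume "x \<in> {x \<in> carrier (?F i). \<phi> i x = (\<lambda>i. 0)}"
          then have "\<exists>w\<in>carrier (?F (Suc i)). x = \<phi> (Suc i) w" using i by (intro lift) auto
          then show "x \<in> \<phi> (Suc i) ` carrier (?F (Suc i))" by auto
        qed
        show "\<phi> (Suc i) ` carrier (?F (Suc i)) \<subseteq> {x \<in> carrier (?F i). \<phi> i x = (\<lambda>i. 0)}"
          unfolding j using closed \<phi>\<phi> by auto
      qed
    qed
    show "\<exists>\<epsilon>\<in>graded_hom (poly_ring A) (?F 0) (graded_ideal A (mono_ideal A P)).
        \<epsilon> ` carrier (?F 0) = carrier (graded_ideal A (mono_ideal A P)) \<and>
        {x \<in> carrier (?F 0). \<epsilon> x = \<zero>\<^bsub>graded_ideal A (mono_ideal A P)\<^esub>} = \<phi> 1 ` carrier (?F 1)"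
    proof (rule bexI[OF _ \<epsilon>_hom], intro conjI)
      show "\<epsilon> ` carrier (?F 0) = carrier (graded_ideal A (mono_ideal A P))"
      proof
        show "\<epsilon> ` carrier (?F 0) \<subseteq> carrier (graded_ideal A (mono_ideal A P))"
          using \<epsilon>_closed by (auto simp: graded_ideal_def)
        show "carrier (graded_ideal A (mono_ideal A P)) \<subseteq> \<epsilon> ` carrier (?F 0)"
        proof
          fix p :: "('v, 'k) mpoly" assume "p \<in> carrier (graded_ideal A (mono_ideal A P))"
          then obtain v where "\<forall>x\<in>X. v x \<in> polys A" "p = (\<Sum>x\<in>X. v x * e x)"
            unfolding graded_ideal_def by (auto simp: image)
          then have "p = \<epsilon> (sec v 0)" "sec v 0 \<in> carrier (?F 0)" using \<epsilon>_sec sec_carrier by auto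
          then show "p \<in> \<epsilon> ` carrier (?F 0)" by auto
        qed
      qed
      show "{x \<in> carrier (?F 0). \<epsilon> x = \<zero>\<^bsub>graded_ideal A (mono_ideal A P)\<^esub>} = \<phi> 1 ` carrier (?F 1)"
      proof
        show "{x \<in> carrier (?F 0). \<epsilon> x = \<zero>\<^bsub>graded_ideal A (mono_ideal A P)\<^esub>} \<subseteq> \<phi> 1 ` carrier (?F 1)"
        proof
          fix x assume "x \<in> {x \<in> carrier (?F 0). \<epsilon> x = \<zero>\<^bsub>graded_ideal A (mono_ideal A P)\<^esub>}"
          then have "\<exists>w\<in>carrier (?F (Suc 0)). x = \<phi> (Suc 0) w"
            by (intro lift) (auto simp: graded_ideal_def)
          then show "x \<in> \<phi> 1 ` carrier (?F 1)" by auto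
        qed
        show "\<phi> 1 ` carrier (?F 1) \<subseteq> {x \<in> carrier (?F 0). \<epsilon> x = \<zero>\<^bsub>graded_ideal A (mono_ideal A P)\<^esub>}"
          using closed \<epsilon>\<phi> by (auto simp: graded_ideal_def)
      qed
    qed
  qed
  then show ?thesis by (intro exI)
qed

section \<open>The resolution of the facet ideal\<close>

text \<open>Substituting zero in the second resolution alters its matrices but not its index set or
  degrees, so the ranks of the product are still counted by \<open>b\<close> and
  \<open>b'\<close>.\<close>

lemma minimal_free_resolution_tensor:
  fixes \<phi> \<phi>' :: "nat \<Rightarrow> (nat \<Rightarrow> ('v, 'k::field) mpoly) \<Rightarrow> (nat \<Rightarrow> ('v, 'k) mpoly)"
  assumes A: "finite A" "D \<subseteq> A"
    and P: "upward P" "depends_on D P" and P': "upward P'" "depends_on C P'"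
    and disjoint: "C \<inter> D = {}"
    and res: "minimal_free_resolution A (linear_shape r l b) \<phi> (graded_ideal A (mono_ideal A P))"
      "minimal_free_resolution A (linear_shape r' l' b') \<phi>' (graded_ideal A (mono_ideal A P'))"
  shows "\<exists>\<psi> :: nat \<Rightarrow> (nat \<Rightarrow> ('v, 'k) mpoly) \<Rightarrow> (nat \<Rightarrow> ('v, 'k) mpoly).
    minimal_free_resolution A
      (linear_shape (r + r') (l + l') (\<lambda>i. \<Sum>u\<le>l. \<Sum>w\<le>l'. if u + w = i then b u * b' w else 0))
      \<psi> (graded_ideal A (mono_ideal A (\<lambda>t. P t \<and> P' t)))"
proof -
  let ?X = "SIGMA i:{..l}. {..<b i}" and ?Y = "SIGMA i:{..l'}. {..<b' i}"
  obtain d :: "nat \<times> nat \<Rightarrow> nat \<times> nat \<Rightarrow> ('v, 'k) mpoly" and e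
    where F: "linear_resolution A P r ?X fst d e"
    using linear_resolution_of_minimal_free_resolution[OF res(1)] by (elim exE)
  obtain d0 :: "nat \<times> nat \<Rightarrow> nat \<times> nat \<Rightarrow> ('v, 'k) mpoly" and e0
    where G0: "linear_resolution A P' r' ?Y fst d0 e0"
    using linear_resolution_of_minimal_free_resolution[OF res(2)] by (elim exE)
  have "finite D" using A finite_subset by auto
  then obtain d' :: "nat \<times> nat \<Rightarrow> nat \<times> nat \<Rightarrow> ('v, 'k) mpoly" and e'
    where G: "linear_resolution A P' r' ?Y fst d' e'" "avoiding D ?Y d' e'"
    using linear_resolution_avoiding[OF _ A(2) _ P' G0] disjoint by (auto simp: Int_commute)
  interpret tensor_resolution A P r ?X fst d e P' r' ?Y fst d' e' D C
    by (intro tensor_resolution.intro tensor_resolution_axioms.intro F G P P' disjoint)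
  show ?thesis
  proof (rule minimal_free_resolution_of_linear_resolution[OF linear_resolution_tensor])
    show "fst (fst p) + fst (snd p) \<le> l + l'" if "p \<in> ?X \<times> ?Y" for p
      using that by (auto intro: add_mono)
    fix i
    define S where "S = {s \<in> {..l} \<times> {..l'}. fst s + snd s = i}"
    have "finite S" by (rule finite_subset[of _ "{..l} \<times> {..l'}"]) (auto simp: S_def)
    have "{p \<in> ?X \<times> ?Y. fst (fst p) + fst (snd p) = i} =
        (\<Union>s\<in>S. ({fst s} \<times> {..<b (fst s)}) \<times> ({snd s} \<times> {..<b' (snd s)}))"
      by (auto simp: S_def)
    also have "card \<dots> = (\<Sum>s\<in>S. b (fst s) * b' (snd s))"
      using \<open>finite S\<close> by (subst card_UN_disjoint) (auto simp: card_cartesian_product)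
    also have "\<dots> = (\<Sum>s\<in>{..l} \<times> {..l'}. if fst s + snd s = i then b (fst s) * b' (snd s) else 0)"
      unfolding S_def by (rule sum.inter_filter) simp
    also have "\<dots> = (\<Sum>u\<le>l. \<Sum>w\<le>l'. if u + w = i then b u * b' w else 0)"
      by (simp add: sum.cartesian_product split_def)
    finally show "card {p \<in> ?X \<times> ?Y. fst (fst p) + fst (snd p) = i} =
        (\<Sum>u\<le>l. \<Sum>w\<le>l'. if u + w = i then b u * b' w else 0)" .
  qed
qed

lemma depends_on_Ball:
  fixes P :: "'i \<Rightarrow> ('v \<Rightarrow>\<^sub>0 nat) \<Rightarrow> bool"
  assumes "\<And>i. i \<in> I \<Longrightarrow> depends_on (D i) (P i)"
  shows "depends_on (\<Union>i\<in>I. D i) (\<lambda>t. \<forall>i\<in>I. P i t)"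
  unfolding depends_on_def
proof (intro allI ball_cong refl)
  fix t :: "'v \<Rightarrow>\<^sub>0 nat" and i assume i: "i \<in> I"
  let ?u = "part (\<lambda>j. j \<in> (\<Union>i\<in>I. D i)) t"
  have "part (\<lambda>j. j \<in> D i) ?u = part (\<lambda>j. j \<in> D i) t"
    by (rule poly_mapping_eqI) (use i in \<open>auto simp: lookup_part\<close>)
  then show "P i t \<longleftrightarrow> P i ?u" using assms[OF i] unfolding depends_on_def by metis
qed

text \<open>The base of the induction over blocks: the whole ring, resolved by itself.\<close>

lemma minimal_free_resolution_unit:
  "\<exists>\<psi> :: nat \<Rightarrow> (nat \<Rightarrow> ('v, 'k::field) mpoly) \<Rightarrow> (nat \<Rightarrow> ('v, 'k) mpoly).
    minimal_free_resolution A (linear_shape 0 0 (\<lambda>i. if i = 0 then 1 else 0)) \<psi>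
      (graded_ideal A (mono_ideal A (\<lambda>_. True)))"
proof (rule minimal_free_resolution_of_linear_resolution)
  show "linear_resolution A (\<lambda>_. True) 0 {()} (\<lambda>_. 0) (\<lambda>_ _. 0 :: ('v, 'k) mpoly) (\<lambda>_. 1)"
  proof
    show "p \<in> mono_ideal A (\<lambda>_. True) \<longleftrightarrow> (\<exists>v. (\<forall>x\<in>{()}. v x \<in> polys A) \<and> p = (\<Sum>x\<in>{()}. v x * 1))"
      for p :: "('v, 'k) mpoly"
      by (auto simp: mono_ideal_def intro: exI[of _ "\<lambda>_. p"])
  qed (auto simp: homogeneous_1 intro: exI[of _ "\<lambda>_. 0"])
qed auto

section \<open>Convolution of the ranks\<close>

lemma sum_PiE_insert:
  fixes f :: "nat \<Rightarrow> nat \<Rightarrow> nat"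
  assumes "finite I" "j \<notin> I" "\<And>x. finite (S x)"
  shows "(\<Sum>u\<in>{u \<in> Pi\<^sub>E (insert j I) S. (\<Sum>x\<in>insert j I. u x) = i}. \<Prod>x\<in>insert j I. f (u x) x) =
    (\<Sum>w\<in>S j. \<Sum>u\<in>{u \<in> Pi\<^sub>E I S. w + (\<Sum>x\<in>I. u x) = i}. f w j * (\<Prod>x\<in>I. f (u x) x))"
proof -
  let ?g = "\<lambda>u. if (\<Sum>x\<in>insert j I. u x) = i then \<Prod>x\<in>insert j I. f (u x) x else 0"
  have fin: "finite (Pi\<^sub>E I S)" "finite (Pi\<^sub>E (insert j I) S)"
    using assms by (auto intro: finite_PiE)
  have "(\<Sum>u\<in>{u \<in> Pi\<^sub>E (insert j I) S. (\<Sum>x\<in>insert j I. u x) = i}. \<Prod>x\<in>insert j I. f (u x) x) =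
      (\<Sum>u\<in>Pi\<^sub>E (insert j I) S. ?g u)"
    by (rule sum.inter_filter[OF fin(2)])
  also have "\<dots> = (\<Sum>(w, u)\<in>S j \<times> Pi\<^sub>E I S. ?g (u(j := w)))"
    unfolding PiE_insert_eq
    by (subst sum.reindex[OF inj_combinator[OF assms(2)]]) (simp add: split_def)
  also have "\<dots> = (\<Sum>w\<in>S j. \<Sum>u\<in>Pi\<^sub>E I S. ?g (u(j := w)))"
    by (simp add: sum.cartesian_product)
  also have "\<dots> = (\<Sum>w\<in>S j. \<Sum>u\<in>Pi\<^sub>E I S. if w + (\<Sum>x\<in>I. u x) = i then f w j * (\<Prod>x\<in>I. f (u x) x) else 0)"
  proof (intro sum.cong refl)
    fix w u
    have "(\<Sum>x\<in>I. (u(j := w)) x) = (\<Sum>x\<in>I. u x)" "(\<Prod>x\<in>I. f ((u(j := w)) x) x) = (\<Prod>x\<in>I. f (u x) x)"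
      using assms(2) by (auto intro!: sum.cong prod.cong)
    then show "?g (u(j := w)) = (if w + (\<Sum>x\<in>I. u x) = i then f w j * (\<Prod>x\<in>I. f (u x) x) else 0)"
      using assms(1,2) by simp
  qed
  also have "\<dots> = (\<Sum>w\<in>S j. \<Sum>u\<in>{u \<in> Pi\<^sub>E I S. w + (\<Sum>x\<in>I. u x) = i}. f w j * (\<Prod>x\<in>I. f (u x) x))"
    by (simp only: sum.inter_filter[OF fin(1)])
  finally show ?thesis .
qed

text \<open>The ranks are coefficients of a product of generating polynomials in the homological
  degree, and adjoining a block multiplies by one more factor. The families over \<open>I\<close>
  are grouped by their total \<open>u\<close>.\<close>

lemma convolution_step:
  fixes f :: "nat \<Rightarrow> nat \<Rightarrow> nat"
  assumes "finite I" "j \<notin> I"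
  shows "(\<Sum>u\<le>(\<Sum>x\<in>I. l x). \<Sum>w\<le>l j. if u + w = i then
        (\<Sum>u\<in>{v \<in> Pi\<^sub>E I (\<lambda>x. {0..l x}). (\<Sum>x\<in>I. v x) = u}. \<Prod>x\<in>I. f (u x) x) * f w j else 0) =
    (\<Sum>u\<in>{u \<in> Pi\<^sub>E (insert j I) (\<lambda>x. {0..l x}). (\<Sum>x\<in>insert j I. u x) = i}. \<Prod>x\<in>insert j I. f (u x) x)"
    (is "?lhs = ?rhs")
proof -
  let ?E = "Pi\<^sub>E I (\<lambda>x. {0..l x})" and ?g = "\<lambda>u. \<Prod>x\<in>I. f (u x) x"
  have fin: "finite ?E" using assms(1) by (intro finite_PiE) auto
  have "?lhs = (\<Sum>w\<le>l j. \<Sum>u\<le>(\<Sum>x\<in>I. l x).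
      \<Sum>v\<in>{v \<in> {v \<in> ?E. w + (\<Sum>x\<in>I. v x) = i}. (\<Sum>x\<in>I. v x) = u}. f w j * ?g v)"
    (is "_ = (\<Sum>w\<le>_. \<Sum>u\<le>_. ?h w u)")
  proof (subst sum.swap, intro sum.cong refl)
    fix w u
    have eq: "{v \<in> {v \<in> ?E. w + (\<Sum>x\<in>I. v x) = i}. (\<Sum>x\<in>I. v x) = u} =
        (if u + w = i then {v \<in> ?E. (\<Sum>x\<in>I. v x) = u} else {})"
      by auto
    show "(if u + w = i then (\<Sum>u\<in>{v \<in> ?E. (\<Sum>x\<in>I. v x) = u}. ?g u) * f w j else 0) = ?h w u"
      unfolding eq by (simp add: sum_distrib_left mult.commute)
  qed
  also have "\<dots> = (\<Sum>w\<le>l j. \<Sum>v\<in>{v \<in> ?E. w + (\<Sum>x\<in>I. v x) = i}. f w j * ?g v)"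
  proof (intro sum.cong refl sum.group)
    fix w
    show "finite {v \<in> ?E. w + (\<Sum>x\<in>I. v x) = i}" using fin by simp
    \<comment> \<open>Every total is at most the sum of the bounds \<open>l x\<close>, so the
      grouping loses no family.\<close>
    show "(\<lambda>v. \<Sum>x\<in>I. v x) ` {v \<in> ?E. w + (\<Sum>x\<in>I. v x) = i} \<subseteq> {..\<Sum>x\<in>I. l x}"
      by (auto intro!: sum_mono dest: PiE_mem)
  qed simp
  also have "\<dots> = ?rhs"
    using sum_PiE_insert[OF assms, where S = "\<lambda>x. {0..l x}" and i = i and f = f] by (simp add: atMost_atLeast0)
  finally show ?thesis .
qed

theorem theorem1:
  fixes n t :: nat
    and indep :: "nat set \<Rightarrow> bool"
    and B :: "nat \<Rightarrow> nat set"
    and r l :: "nat \<Rightarrow> nat"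
    and b :: "nat \<Rightarrow> nat \<Rightarrow> nat"
    and \<beta> :: "nat \<Rightarrow> nat"
    and \<phi> :: "nat \<Rightarrow> nat \<Rightarrow> (nat \<Rightarrow> (nat, 'k::field) mpoly) \<Rightarrow> (nat \<Rightarrow> (nat, 'k) mpoly)"
  assumes M: "matroid {1..n} indep"
    and B: "bij_betw B {1..t} (blocks {1..n} indep)"
    and res: "\<And>i. i \<in> {1..t} \<Longrightarrow>
      minimal_free_resolution {1..n} (linear_shape (r i) (l i) (\<lambda>u. b u i)) (\<phi> i)
        (graded_ideal {1..n} (facet_ideal {1..n} (restrict_indep indep (B i))))"
    and \<beta>: "\<And>i. \<beta> i =
      (\<Sum>u\<in>{u \<in> Pi\<^sub>E {1..t} (\<lambda>j. {0..l j}). (\<Sum>j=1..t. u j) = i}. \<Prod>j=1..t. b (u j) j)"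
  shows "\<exists>\<psi> :: nat \<Rightarrow> (nat \<Rightarrow> (nat, 'k) mpoly) \<Rightarrow> (nat \<Rightarrow> (nat, 'k) mpoly).
      minimal_free_resolution {1..n} (linear_shape (\<Sum>j=1..t. r j) (\<Sum>j=1..t. l j) \<beta>) \<psi>
        (graded_ideal {1..n} (facet_ideal {1..n} indep))"
proof -
  interpret matroid "{1..n}" indep by (rule M)
  let ?A = "{1..n}"
  let ?P = "\<lambda>i s. \<exists>\<sigma>. basis (restrict_indep indep (B i)) \<sigma> \<and> \<sigma> \<subseteq> Poly_Mapping.keys s"
  let ?Q = "\<lambda>I s. \<forall>i\<in>I. ?P i s"
  \<comment> \<open>The ranks for the blocks in \<open>I\<close> alone, as the induction over sets
    of blocks requires.\<close>
  define bet where "bet I i = (\<Sum>u\<in>{u \<in> Pi\<^sub>E I (\<lambda>j. {0..l j}). (\<Sum>j\<in>I. u j) = i}. \<Prod>j\<in>I. b (u j) j)" for I i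
  have blk: "B i \<in> blocks ?A indep" if "i \<in> {1..t}" for i
    using bij_betwE[OF B] that by blast
  have BA: "B i \<subseteq> ?A" if "i \<in> {1..t}" for i
    using blk[OF that] Union_blocks by blast
  have facet: "facet_ideal ?A (restrict_indep indep (B i)) = mono_ideal ?A (?P i)" for i
    using indep_ground indep_finite
    by (intro facet_ideal_eq_mono_ideal) (auto simp: basis_def restrict_indep_def)
  have up: "upward (?P i)" for i
    unfolding upward_def keys_add_nat by blast
  have dep: "depends_on (B i) (?P i)" for i
  proof -
    have "\<sigma> \<subseteq> B i" if "basis (restrict_indep indep (B i)) \<sigma>" for \<sigma>
      using that by (simp add: basis_def restrict_indep_def)
    then show ?thesis unfolding depends_on_def keys_part by blast
  qed
  have partial: "\<exists>\<psi> :: nat \<Rightarrow> (nat \<Rightarrow> (nat, 'k) mpoly) \<Rightarrow> (nat \<Rightarrow> (nat, 'k) mpoly).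
      minimal_free_resolution ?A (linear_shape (\<Sum>j\<in>I. r j) (\<Sum>j\<in>I. l j) (bet I)) \<psi>
        (graded_ideal ?A (mono_ideal ?A (?Q I)))"
    if "finite I" "I \<subseteq> {1..t}" for I
    using that
  proof (induction I rule: finite_induct)
    case empty
    have "bet {} = (\<lambda>i. if i = 0 then 1 else 0)" by (auto simp: bet_def)
    then show ?case using minimal_free_resolution_unit[of ?A] by simp
  next
    case (insert j I)
    let ?D = "\<Union>i\<in>I. B i"
    from insert obtain \<psi> :: "nat \<Rightarrow> (nat \<Rightarrow> (nat, 'k) mpoly) \<Rightarrow> (nat \<Rightarrow> (nat, 'k) mpoly)"
      where \<psi>: "minimal_free_resolution ?A (linear_shape (\<Sum>j\<in>I. r j) (\<Sum>j\<in>I. l j) (bet I)) \<psi>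
        (graded_ideal ?A (mono_ideal ?A (?Q I)))"
      by auto
    have j: "minimal_free_resolution ?A (linear_shape (r j) (l j) (\<lambda>u. b u j)) (\<phi> j)
        (graded_ideal ?A (mono_ideal ?A (?P j)))"
      using res[of j] insert.prems unfolding facet by simp
    have disj: "B j \<inter> ?D = {}"
    proof -
      have "B j \<inter> B i = {}" if "i \<in> I" for i
      proof (rule blocks_disjoint)
        show "B j \<in> blocks ?A indep" "B i \<in> blocks ?A indep" using blk insert.prems that by auto
        show "B j \<noteq> B i"
          using inj_onD[OF bij_betw_imp_inj_on[OF B], of j i] insert.hyps insert.prems that by auto
      qed
      then show ?thesis by blast
    qed
    have upI: "upward (?Q I)" using up unfolding upward_def by blast
    have depI: "depends_on ?D (?Q I)" by (rule depends_on_Ball) (rule dep)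
    have DA: "?D \<subseteq> ?A" using BA insert.prems by blast
    have Q_eq: "(\<lambda>s. ?Q I s \<and> ?P j s) = ?Q (insert j I)" by auto
    have bet_eq: "(\<lambda>i. \<Sum>u\<le>(\<Sum>x\<in>I. l x). \<Sum>w\<le>l j. if u + w = i then bet I u * b w j else 0) = bet (insert j I)"
      unfolding bet_def by (rule ext) (rule convolution_step[OF insert.hyps(1,2), where f = b])
    have sum_eq: "(\<Sum>x\<in>insert j I. f x) = (\<Sum>x\<in>I. f x) + f j" for f :: "nat \<Rightarrow> nat"
      using insert.hyps by simp
    \<comment> \<open>The blocks of \<open>I\<close> form the first factor and block
      \<open>j\<close> the second, whose matrices lose the variables of all blocks in
      \<open>I\<close>.\<close>
    show ?case
      using minimal_free_resolution_tensor[OF finite_atLeastAtMost DA upI depI up dep disj \<psi> j]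
      unfolding Q_eq bet_eq sum_eq .
  qed
  have "\<exists>\<psi> :: nat \<Rightarrow> (nat \<Rightarrow> (nat, 'k) mpoly) \<Rightarrow> (nat \<Rightarrow> (nat, 'k) mpoly).
      minimal_free_resolution ?A (linear_shape (\<Sum>j=1..t. r j) (\<Sum>j=1..t. l j) (bet {1..t})) \<psi>
        (graded_ideal ?A (mono_ideal ?A (?Q {1..t})))"
    by (rule partial) simp_all
  moreover have "bet {1..t} = \<beta>" unfolding bet_def by (rule ext) (simp only: \<beta>)
  moreover have "(facet_ideal ?A indep :: (nat, 'k) mpoly set) = mono_ideal ?A (?Q {1..t})"
  proof -
    have "(facet_ideal ?A indep :: (nat, 'k) mpoly set) =
        mono_ideal ?A (\<lambda>s. \<exists>\<sigma>. basis indep \<sigma> \<and> \<sigma> \<subseteq> Poly_Mapping.keys s)"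
      using indep_ground indep_finite by (intro facet_ideal_eq_mono_ideal) (auto simp: basis_def)
    moreover have "blocks ?A indep = B ` {1..t}" using B by (simp add: bij_betw_def)
    ultimately show ?thesis by (simp add: basis_subset_iff_blocks)
  qed
  ultimately show ?thesis by simp
qed

end
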